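(* Let $\varphi:\mathbb{R}^d\to\mathbb{R}^d$ be smooth and let $\psi\in C^\infty(\mathbb{R}^d)$ be of small decay with respect to $\varphi$. Then $C_{\psi,\varphi}$ acts on $\mathscr{S}(\mathbb{R}^d)$ if and only if for each $\alpha\in\mathbb{N}_0^d$ and $p>0$ there is $q>0$ such that $$\sup_{x\in\mathbb{R}^d}\frac{(1+|x|)^p}{(1+|\varphi(x)|)^q}|\psi^{(\alpha)}(x)|<\infty\quad\text{and}\quad\sup_{x\in\mathbb{R}^d}\frac{1}{(1+|\varphi(x)|)^q}|\varphi^{(\alpha)}(x)|<\infty.$$
   Context: $\mathscr{S}(\mathbb{R}^d)$ is the Schwartz space of complex-valued rapidly decreasing smooth functions; $|x|$ is the Euclidean norm; $\psi$ is complex-valued. $C_{\psi,\varphi}f=\psi\cdot(f\circ\varphi)$; $C_{\psi,\varphi}$ acts on $\mathscr{S}(\mathbb{R}^d)$ if $C_{\psi,\varphi}f\in\mathscr{S}(\mathbb{R}^d)$ for every $f\in\mathscr{S}(\mathbb{R}^d)$. For a multi-index $\alpha$, $\varphi^{(\alpha)}=(\varphi_1^{(\alpha)},\dots,\varphi_d^{(\alpha)})$ with $f^{(\alpha)}=\partial^\alpha f$. $\psi\in C^\infty(\mathbb{R}^d)$ is of small decay with respect to the smooth map $\varphi:\mathbb{R}^d\to\mathbb{R}^d$ if there is $m>0$ such that $\inf_{|x|\ge m}(1+|x|)^m(1+|\varphi(x)|)^m|\psi(x)|>0$. *)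

theory Defs
  imports "HOL-Analysis.Analysis"
begin

definition partial :: "'d \<Rightarrow> (real^'d \<Rightarrow> 'b) \<Rightarrow> real^('d::finite) \<Rightarrow> 'b::real_normed_vector"
  where "partial i f x = frechet_derivative f (at x) (axis i 1)"

definition partials :: "'d list \<Rightarrow> (real^'d \<Rightarrow> 'b) \<Rightarrow> real^('d::finite) \<Rightarrow> 'b::real_normed_vector"
  where "partials is f = foldr partial is f"

text \<open>The list \<open>is\<close> ranges over all lists, hence also over all suffixes of a given one, so every \<open>frechet_derivative\<close> involved is
  a genuine derivative; this is \<open>C\<^sup>\<infinity>\<close> in the sense of infinite Frechet differentiability.\<close>

definition smooth :: "(real^('d::finite) \<Rightarrow> 'b::real_normed_vector) \<Rightarrow> bool"
  where "smooth f \<longleftrightarrow> (\<forall>is x. partials is f differentiable (at x))"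

text \<open>A multi-index is a function \<open>\<alpha> :: 'd \<Rightarrow> nat\<close>. The derivative of order \<open>\<alpha>\<close> differentiates
  \<open>\<alpha> i\<close> times in direction \<open>i\<close>; the index type carries no order, so the sequence in
  which this is done is chosen arbitrarily, which is immaterial for smooth functions
  (symmetry of mixed partial derivatives).\<close>

definition mderiv :: "('d \<Rightarrow> nat) \<Rightarrow> (real^'d \<Rightarrow> 'b) \<Rightarrow> real^('d::finite) \<Rightarrow> 'b::real_normed_vector"
  where "mderiv \<alpha> f = partials (SOME is. \<forall>i. count_list is i = \<alpha> i) f"

definition mderiv_vec :: "('d \<Rightarrow> nat) \<Rightarrow> (real^'d \<Rightarrow> real^'n) \<Rightarrow> real^('d::finite) \<Rightarrow> real^('n::finite)"
  where "mderiv_vec \<alpha> \<phi> x = (\<chi> j. mderiv \<alpha> (\<lambda>y. \<phi> y $ j) x)"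

definition schwartz :: "(real^('d::finite) \<Rightarrow> complex) set"
  where "schwartz = {f. smooth f \<and>
    (\<forall>(k::nat) \<alpha>. bdd_above (range (\<lambda>x. (1 + norm x) ^ k * cmod (mderiv \<alpha> f x))))}"

definition weighted_comp ::
    "(real^'d \<Rightarrow> complex) \<Rightarrow> (real^'d \<Rightarrow> real^'d) \<Rightarrow> (real^'d \<Rightarrow> complex) \<Rightarrow> real^('d::finite) \<Rightarrow> complex"
  where "weighted_comp \<psi> \<phi> f = (\<lambda>x. \<psi> x * f (\<phi> x))"

definition acts_on_schwartz :: "(real^'d \<Rightarrow> complex) \<Rightarrow> (real^'d \<Rightarrow> real^('d::finite)) \<Rightarrow> bool"
  where "acts_on_schwartz \<psi> \<phi> \<longleftrightarrow> (\<forall>f\<in>schwartz. weighted_comp \<psi> \<phi> f \<in> schwartz)"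

text \<open>The infimum is over a nonempty set of nonnegative reals, so the conditionally complete
  \<open>Inf\<close> on \<open>real\<close> is the genuine one.\<close>

definition small_decay :: "(real^'d \<Rightarrow> complex) \<Rightarrow> (real^'d \<Rightarrow> real^('d::finite)) \<Rightarrow> bool"
  where "small_decay \<psi> \<phi> \<longleftrightarrow>
    (\<exists>m>0. (INF x\<in>{x. norm x \<ge> m}.
       (1 + norm x) powr m * (1 + norm (\<phi> x)) powr m * cmod (\<psi> x)) > 0)"

end

theory Submission
  imports Defs "HOL-Computational_Algebra.Polynomial"
begin

text \<open>If the operator acts, apply it to sums of widely separated bumps: such a function is a constant
  \<open>c\<close> near each centre, where every derivative of \<open>\<psi> \<cdot> (f \<circ> \<phi>)\<close> is just \<open>c\<close> times that
  derivative of \<open>\<psi>\<close>, and a gliding hump argument yields the bounds on \<open>\<psi>\<close>. Multiplication by a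
  coordinate preserves the Schwartz space, so the same bounds hold for \<open>\<psi> \<cdot> \<phi>\<^sub>j\<close>; the Leibniz rule and
  induction on the order then bound \<open>\<psi>\<close> times each derivative of \<open>\<phi>\<^sub>j\<close>, and small decay allows
  dividing by \<open>\<psi>\<close>. The converse is the chain rule.\<close>

section \<open>Iterated partial derivatives\<close>

text \<open>The obstacle is that a derivative of \<psi> * (f o \<phi>) mixes derivatives of \<psi>,
  \<phi> and f. Local constancy of f removes those of \<phi>, so \<psi> can be bounded before
  anything is known about \<phi>. The bump heights (1 + |y_n|)^(-n) are a compromise: they decrease
  faster than every fixed power, which makes the sum a Schwartz function, yet at y_n they lose only
  the n-th power, which a bound failing with exponent n compensates. The bumps can be separated only
  if the failing points have arbitrarily large |\<phi>(x)|; this needs a separate bound on the sets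
  where |\<phi>| stays bounded. Division by \<psi> is possible only outside a ball, since \<psi> may
  vanish inside; there continuity takes over. Since \<open>mderiv\<close> differentiates in one
  unspecified order, bounds on multi-index derivatives reach arbitrary lists of directions only
  through the symmetry of mixed partials. Lists are the working form because inductions remove one
  derivative at a time.\<close>

lemma partials_Nil [simp]: "partials [] f = f"
  by (simp add: partials_def)

lemma partials_Cons [simp]: "partials (i # is) f = partial i (partials is f)"
  by (simp add: partials_def)

lemma partials_append: "partials (is @ js) f = partials is (partials js f)"
  by (simp add: partials_def)

lemma smoothD: "smooth f \<Longrightarrow> f differentiable at x"
  unfolding smooth_def by (metis partials_Nil)

lemma smooth_partials: "smooth f \<Longrightarrow> smooth (partials is f)"
  unfolding smooth_def by (metis partials_append)

lemma smooth_partial: "smooth f \<Longrightarrow> smooth (partial i f)"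
  using smooth_partials[of f "[i]"] by simp

lemma smooth_continuous_on: "smooth f \<Longrightarrow> continuous_on S f"
  by (meson continuous_at_imp_continuous_on differentiable_imp_continuous_within smoothD)

lemma partial_eqI: "(f has_derivative D) (at x) \<Longrightarrow> partial i f x = D (axis i 1)"
  unfolding partial_def by (metis frechet_derivative_at)

lemma has_derivative_smooth:
  "smooth f \<Longrightarrow> (f has_derivative frechet_derivative f (at x)) (at x)"
  by (meson frechet_derivative_works smoothD)

text \<open>\<open>frechet_derivative\<close> is a choice among the maps that are derivatives at the
  point, and by locality both functions have the same ones; the choices agree even where there are
  none.\<close>

lemma partials_cong_open:
  assumes "open S" "\<And>y. y \<in> S \<Longrightarrow> f y = g y" "x \<in> S"
  shows "partials is f x = partials is g x"
  using assms(3)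
proof (induction "is" arbitrary: x)
  case (Cons i "is")
  have "(partials is f has_derivative D) (at x) \<longleftrightarrow> (partials is g has_derivative D) (at x)" for D
    using has_derivative_transform_within_open[OF _ assms(1) Cons.prems] Cons.IH
    by (metis (no_types, lifting))
  then show ?case by (simp add: partial_def frechet_derivative_def)
qed (use assms in simp)

lemma partial_const [simp]: "partial i (\<lambda>x. c) = (\<lambda>x. 0)"
  by (rule ext) (simp add: partial_def)

lemma partials_zero: "partials is (\<lambda>x. 0) = (\<lambda>x. 0)"
  by (induction "is") auto

lemma partials_bounded_linear:
  assumes "bounded_linear L" "smooth f"
  shows "partials is (\<lambda>x. L (f x)) = (\<lambda>x. L (partials is f x))"
proof (induction "is")
  case (Cons i "is")
  have "((\<lambda>x. L (partials is f x)) has_derivative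
      (\<lambda>h. L (frechet_derivative (partials is f) (at x) h))) (at x)" for x
    by (rule bounded_linear.has_derivative[OF assms(1) has_derivative_smooth[OF smooth_partials[OF assms(2)]]])
  then show ?case
    unfolding partials_Cons Cons.IH by (auto simp: fun_eq_iff partial_def[of _ "partials is f"] dest: partial_eqI)
qed simp

lemma smooth_bounded_linear:
  assumes "bounded_linear L" "smooth f"
  shows "smooth (\<lambda>x. L (f x))"
  unfolding smooth_def partials_bounded_linear[OF assms]
  using bounded_linear.has_derivative[OF assms(1) has_derivative_smooth[OF smooth_partials[OF assms(2)]]]
  by (auto simp: differentiable_def)

section \<open>Symmetry of mixed partial derivatives\<close>

lemma has_real_derivative_along:
  fixes f :: "real^('d::finite) \<Rightarrow> real"
  assumes "smooth f"
  shows "((\<lambda>s. f (x + s *\<^sub>R axis i 1)) has_real_derivative partial i f (x + s *\<^sub>R axis i 1)) (at s)"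
proof -
  let ?D = "frechet_derivative f (at (x + s *\<^sub>R axis i 1))"
  have D: "(f has_derivative ?D) (at (x + s *\<^sub>R axis i 1))"
    by (rule has_derivative_smooth[OF assms])
  have "((\<lambda>s. f (x + s *\<^sub>R axis i 1)) has_derivative (\<lambda>h. ?D (h *\<^sub>R axis i 1))) (at s)"
    by (rule has_derivative_compose[of "\<lambda>s. x + s *\<^sub>R axis i 1", OF _ D])
      (auto intro!: derivative_eq_intros)
  moreover have "?D (h *\<^sub>R axis i 1) = partial i f (x + s *\<^sub>R axis i 1) * h" for h
    using linear_cmul[OF has_derivative_linear[OF D]] by (simp add: partial_def)
  ultimately show ?thesis by (simp add: has_field_derivative_def)
qed

text \<open>The mean value theorem is applied twice: along i to the increment of f in direction j,
  then along j to the increment of the derivative so obtained. The left side is symmetric in i and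
  j.\<close>

lemma second_difference:
  fixes f :: "real^('d::finite) \<Rightarrow> real"
  assumes "smooth f" "h > 0"
  obtains s t where "0 < s" "s < h" "0 < t" "t < h"
    "f (x + h *\<^sub>R axis i 1 + h *\<^sub>R axis j 1) - f (x + h *\<^sub>R axis i 1) - f (x + h *\<^sub>R axis j 1) + f x
      = h\<^sup>2 * partial j (partial i f) (x + s *\<^sub>R axis i 1 + t *\<^sub>R axis j 1)"
proof -
  let ?a = "axis i 1 :: real^'d" and ?b = "axis j 1 :: real^'d"
  define g where "g s = f ((x + h *\<^sub>R ?b) + s *\<^sub>R ?a) - f (x + s *\<^sub>R ?a)" for s
  have "(g has_real_derivative
      partial i f ((x + h *\<^sub>R ?b) + s *\<^sub>R ?a) - partial i f (x + s *\<^sub>R ?a)) (at s)" for s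
    unfolding g_def by (intro DERIV_diff has_real_derivative_along assms)
  then obtain s where s: "0 < s" "s < h" "g h - g 0 =
      (h - 0) * (partial i f ((x + h *\<^sub>R ?b) + s *\<^sub>R ?a) - partial i f (x + s *\<^sub>R ?a))"
    using MVT2[OF assms(2), of g "\<lambda>s. partial i f ((x + h *\<^sub>R ?b) + s *\<^sub>R ?a) - partial i f (x + s *\<^sub>R ?a)"]
    by blast
  obtain t where t: "0 < t" "t < h"
    "partial i f ((x + s *\<^sub>R ?a) + h *\<^sub>R ?b) - partial i f ((x + s *\<^sub>R ?a) + 0 *\<^sub>R ?b) =
      (h - 0) * partial j (partial i f) ((x + s *\<^sub>R ?a) + t *\<^sub>R ?b)"
    using MVT2[OF assms(2), of "\<lambda>t. partial i f ((x + s *\<^sub>R ?a) + t *\<^sub>R ?b)"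
        "\<lambda>t. partial j (partial i f) ((x + s *\<^sub>R ?a) + t *\<^sub>R ?b)"]
      has_real_derivative_along[OF smooth_partial[OF assms(1)]] by blast
  have "g h - g 0 = h\<^sup>2 * partial j (partial i f) (x + s *\<^sub>R ?a + t *\<^sub>R ?b)"
    using s(3) t(3) by (simp add: algebra_simps power2_eq_square)
  then show thesis
    using that[OF s(1,2) t(1,2)] by (simp add: g_def algebra_simps)
qed

text \<open>The symmetric second difference forces the two mixed partials to agree at points, one
  for each of them, that tend to x as the step 1 / (n + 1) shrinks. Both partials are
  continuous.\<close>

lemma partial_commute_real:
  fixes f :: "real^('d::finite) \<Rightarrow> real"
  assumes "smooth f"
  shows "partial i (partial j f) x = partial j (partial i f) x"
proof -
  let ?a = "axis i 1 :: real^'d" and ?b = "axis j 1 :: real^'d"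
  define h :: "nat \<Rightarrow> real" where "h n = 1 / Suc n" for n
  have h: "h n > 0" for n by (simp add: h_def)
  have h0: "h \<longlonglongrightarrow> 0" unfolding h_def by (rule LIMSEQ_Suc[OF lim_1_over_n])
  have "\<exists>s t s' t'. 0 < s \<and> s < h n \<and> 0 < t \<and> t < h n \<and> 0 < s' \<and> s' < h n \<and> 0 < t' \<and> t' < h n \<and>
     partial j (partial i f) (x + s *\<^sub>R ?a + t *\<^sub>R ?b) = partial i (partial j f) (x + s' *\<^sub>R ?b + t' *\<^sub>R ?a)" for n
  proof -
    obtain s t where st: "0 < s" "s < h n" "0 < t" "t < h n"
      and 1: "f (x + h n *\<^sub>R ?a + h n *\<^sub>R ?b) - f (x + h n *\<^sub>R ?a) - f (x + h n *\<^sub>R ?b) + f x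
      = (h n)\<^sup>2 * partial j (partial i f) (x + s *\<^sub>R ?a + t *\<^sub>R ?b)"
      using second_difference[OF assms h] by blast
    obtain s' t' where st': "0 < s'" "s' < h n" "0 < t'" "t' < h n"
      and 2: "f (x + h n *\<^sub>R ?b + h n *\<^sub>R ?a) - f (x + h n *\<^sub>R ?b) - f (x + h n *\<^sub>R ?a) + f x
      = (h n)\<^sup>2 * partial i (partial j f) (x + s' *\<^sub>R ?b + t' *\<^sub>R ?a)"
      using second_difference[OF assms h] by blast
    have "(h n)\<^sup>2 * partial j (partial i f) (x + s *\<^sub>R ?a + t *\<^sub>R ?b)
        = (h n)\<^sup>2 * partial i (partial j f) (x + s' *\<^sub>R ?b + t' *\<^sub>R ?a)"
      unfolding 1[symmetric] 2[symmetric] by (simp add: algebra_simps)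
    with h[of n] st st' show ?thesis by fastforce
  qed
  then obtain s t s' t' where B: "\<And>n. 0 < s n" "\<And>n. s n < h n" "\<And>n. 0 < t n" "\<And>n. t n < h n"
      "\<And>n. 0 < s' n" "\<And>n. s' n < h n" "\<And>n. 0 < t' n" "\<And>n. t' n < h n"
    and eq: "\<And>n. partial j (partial i f) (x + s n *\<^sub>R ?a + t n *\<^sub>R ?b)
      = partial i (partial j f) (x + s' n *\<^sub>R ?b + t' n *\<^sub>R ?a)"
    by metis
  have lims: "s \<longlonglongrightarrow> 0" "t \<longlonglongrightarrow> 0" "s' \<longlonglongrightarrow> 0" "t' \<longlonglongrightarrow> 0"
    by (rule tendsto_sandwich[OF _ _ tendsto_const h0]; simp add: B less_imp_le)+
  have c: "isCont (partial k (partial l f)) x" for k l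
    by (intro differentiable_imp_continuous_within smoothD smooth_partial assms)
  have "(\<lambda>n. x + s n *\<^sub>R ?a + t n *\<^sub>R ?b) \<longlonglongrightarrow> x + 0 *\<^sub>R ?a + 0 *\<^sub>R ?b"
    "(\<lambda>n. x + s' n *\<^sub>R ?b + t' n *\<^sub>R ?a) \<longlonglongrightarrow> x + 0 *\<^sub>R ?b + 0 *\<^sub>R ?a"
    by (intro tendsto_intros lims)+
  then have "(\<lambda>n. partial j (partial i f) (x + s n *\<^sub>R ?a + t n *\<^sub>R ?b)) \<longlonglongrightarrow> partial j (partial i f) x"
    "(\<lambda>n. partial i (partial j f) (x + s' n *\<^sub>R ?b + t' n *\<^sub>R ?a)) \<longlonglongrightarrow> partial i (partial j f) x"
    using isCont_tendsto_compose[OF c] by simp_all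
  then show ?thesis unfolding eq using LIMSEQ_unique by blast
qed

text \<open>The mean value theorem has no equality form for vector values, so inner products with
  basis vectors reduce the claim to real functions.\<close>

lemma partial_commute:
  fixes f :: "real^('d::finite) \<Rightarrow> 'b::euclidean_space"
  assumes "smooth f"
  shows "partial i (partial j f) = partial j (partial i f)"
proof
  fix x
  show "partial i (partial j f) x = partial j (partial i f) x"
  proof (rule euclidean_eqI)
    fix b :: 'b assume "b \<in> Basis"
    have bl: "bounded_linear (\<lambda>y. y \<bullet> b)" by (rule bounded_linear_inner_left)
    have "partial k (partial l f) x \<bullet> b = partial k (partial l (\<lambda>x. f x \<bullet> b)) x" for k l
      using partials_bounded_linear[OF bl assms, of "[k, l]"] by simp
    then show "partial i (partial j f) x \<bullet> b = partial j (partial i f) x \<bullet> b"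
      using partial_commute_real[OF smooth_bounded_linear[OF bl assms]] by simp
  qed
qed

lemma partials_mset_cong:
  fixes f :: "real^('d::finite) \<Rightarrow> 'b::euclidean_space"
  assumes "smooth f" "mset is = mset js"
  shows "partials is f = partials js f"
  using assms(2)
proof (induction "is" arbitrary: js)
  case (Cons i "is")
  have move: "partials (xs @ i # ys) f = partials (i # xs @ ys) f" for xs ys
  proof (induction xs)
    case (Cons a xs)
    then show ?case
      using partial_commute[OF smooth_partials[OF assms(1)], of a i "xs @ ys"] by simp
  qed simp
  have "i \<in> set js" using Cons.prems by (metis list.set_intros(1) set_mset_mset)
  then obtain xs ys where js: "js = xs @ i # ys" by (meson split_list)
  with Cons have "partials is f = partials (xs @ ys) f" by simp
  then show ?case using move js by simp
qed simp

text \<open>The list chosen inside \<open>mderiv\<close> has the same multiset of directions as the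
  given one. This carries hypotheses on \<open>mderiv\<close> over to every list; the opposite
  passage is immediate from the definition.\<close>

lemma partials_eq_mderiv:
  fixes f :: "real^('d::finite) \<Rightarrow> 'b::euclidean_space"
  assumes "smooth f"
  shows "partials is f = mderiv (count_list is) f"
proof -
  define js where "js = (SOME js. \<forall>i. count_list js i = count_list is i)"
  have "\<forall>i. count_list js i = count_list is i"
    unfolding js_def by (rule someI[of _ "is"]) simp
  then have "mset js = mset is" by (simp add: multiset_eq_iff count_mset)
  then show ?thesis
    using partials_mset_cong[OF assms, of js "is"] by (simp add: mderiv_def js_def)
qed

text \<open>Products and compositions are shown to be smooth by induction on \<open>n\<close>, for all factors at once.\<close>

definition ksmooth :: "nat \<Rightarrow> (real^('d::finite) \<Rightarrow> 'b::real_normed_vector) \<Rightarrow> bool"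
  where "ksmooth n f \<longleftrightarrow> (\<forall>is x. length is \<le> n \<longrightarrow> partials is f differentiable (at x))"

lemma smooth_iff_ksmooth: "smooth f \<longleftrightarrow> (\<forall>n. ksmooth n f)"
  unfolding smooth_def ksmooth_def by blast

lemma ksmooth_0: "ksmooth 0 f \<longleftrightarrow> (\<forall>x. f differentiable (at x))"
  by (simp add: ksmooth_def)

text \<open>This splits off the innermost derivative, the last list entry, whereas
  \<open>partials_Cons\<close> splits off the outermost. The product and chain rules apply to the
  innermost one, so the inductions run in this direction.\<close>

lemma ksmooth_Suc:
  "ksmooth (Suc n) f \<longleftrightarrow> (\<forall>x. f differentiable (at x)) \<and> (\<forall>i. ksmooth n (partial i f))"
proof
  assume L: "ksmooth (Suc n) f"
  have "partials is (partial i f) differentiable (at x)" if "length is \<le> n" for "is" i x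
    using L[unfolded ksmooth_def, rule_format, of "is @ [i]" x] that by (simp add: partials_append)
  moreover have "f differentiable (at x)" for x
    using L[unfolded ksmooth_def, rule_format, of "[]" x] by simp
  ultimately show "(\<forall>x. f differentiable (at x)) \<and> (\<forall>i. ksmooth n (partial i f))"
    by (simp add: ksmooth_def)
next
  assume R: "(\<forall>x. f differentiable (at x)) \<and> (\<forall>i. ksmooth n (partial i f))"
  have "partials is f differentiable (at x)" if "length is \<le> Suc n" for "is" x
  proof (cases "is" rule: rev_cases)
    case (snoc js i)
    with R that show ?thesis by (simp add: ksmooth_def partials_append)
  qed (use R in simp)
  then show "ksmooth (Suc n) f" by (simp add: ksmooth_def)
qed

lemma ksmooth_differentiable: "ksmooth n f \<Longrightarrow> f differentiable (at x)"
  unfolding ksmooth_def by (metis le0 list.size(3) partials_Nil)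

lemma smooth_iff_partial:
  "smooth f \<longleftrightarrow> (\<forall>x. f differentiable (at x)) \<and> (\<forall>i. smooth (partial i f))"
  unfolding smooth_iff_ksmooth by (metis ksmooth_0 ksmooth_Suc not0_implies_Suc)

lemma ksmooth_mono: "ksmooth n f \<Longrightarrow> m \<le> n \<Longrightarrow> ksmooth m f"
  by (simp add: ksmooth_def)

lemma smooth_const [simp]: "smooth (\<lambda>x :: real^('d::finite). c :: 'b::real_normed_vector)"
proof -
  have "ksmooth n (\<lambda>x :: real^'d. c)" for n and c :: 'b
    by (induction n arbitrary: c) (simp_all add: ksmooth_0 ksmooth_Suc)
  then show ?thesis by (simp add: smooth_iff_ksmooth)
qed

lemma partial_add:
  assumes "\<And>x. f differentiable (at x)" "\<And>x. g differentiable (at x)"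
  shows "partial i (\<lambda>x. f x + g x) = (\<lambda>x. partial i f x + partial i g x)"
  using partial_eqI[OF has_derivative_add[OF assms(1)[unfolded frechet_derivative_works]
    assms(2)[unfolded frechet_derivative_works]]]
  by (simp add: partial_def fun_eq_iff)

lemma ksmooth_add: "ksmooth n f \<Longrightarrow> ksmooth n g \<Longrightarrow> ksmooth n (\<lambda>x. f x + g x)"
proof (induction n arbitrary: f g)
  case (Suc n)
  then show ?case by (simp add: ksmooth_Suc partial_add differentiable_add)
qed (simp add: ksmooth_0 differentiable_add)

lemma smooth_add: "smooth f \<Longrightarrow> smooth g \<Longrightarrow> smooth (\<lambda>x. f x + g x)"
  by (simp add: smooth_iff_ksmooth ksmooth_add)

lemma ksmooth_sum:
  assumes "finite A" "\<And>a. a \<in> A \<Longrightarrow> ksmooth n (f a)"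
  shows "ksmooth n (\<lambda>x. \<Sum>a\<in>A. f a x)"
  using assms
proof (induction A rule: finite_induct)
  case empty
  then show ?case by (simp add: smooth_const[unfolded smooth_iff_ksmooth])
qed (simp add: ksmooth_add)

lemma smooth_sum:
  "finite A \<Longrightarrow> (\<And>a. a \<in> A \<Longrightarrow> smooth (f a)) \<Longrightarrow> smooth (\<lambda>x. \<Sum>a\<in>A. f a x)"
  by (simp add: smooth_iff_ksmooth ksmooth_sum)

lemma partials_add:
  assumes "smooth f" "smooth g"
  shows "partials is (\<lambda>x. f x + g x) = (\<lambda>x. partials is f x + partials is g x)"
proof (induction "is")
  case (Cons i "is")
  then show ?case using smooth_partials[OF assms(1)] smooth_partials[OF assms(2)]
    by (simp add: partial_add smoothD)
qed simp

lemma partials_sum: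
  assumes "finite A" "\<And>a. a \<in> A \<Longrightarrow> smooth (f a)"
  shows "partials is (\<lambda>x. \<Sum>a\<in>A. f a x) = (\<lambda>x. \<Sum>a\<in>A. partials is (f a) x)"
  using assms
proof (induction A rule: finite_induct)
  case empty
  then show ?case by (simp add: partials_zero)
next
  case (insert a A)
  then show ?case by (simp add: partials_add smooth_sum)
qed

lemma partial_mult:
  fixes f g :: "real^('d::finite) \<Rightarrow> 'b::real_normed_algebra"
  assumes "\<And>x. f differentiable (at x)" "\<And>x. g differentiable (at x)"
  shows "partial i (\<lambda>x. f x * g x) = (\<lambda>x. f x * partial i g x + partial i f x * g x)"
  using partial_eqI[OF has_derivative_mult[OF assms(1)[unfolded frechet_derivative_works]
    assms(2)[unfolded frechet_derivative_works]]]
  by (simp add: partial_def fun_eq_iff)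

lemma ksmooth_mult:
  fixes f g :: "real^('d::finite) \<Rightarrow> 'b::real_normed_algebra"
  shows "ksmooth n f \<Longrightarrow> ksmooth n g \<Longrightarrow> ksmooth n (\<lambda>x. f x * g x)"
proof (induction n arbitrary: f g)
  case (Suc n)
  note d = ksmooth_differentiable[OF Suc.prems(1)] ksmooth_differentiable[OF Suc.prems(2)]
  have "ksmooth n f" "ksmooth n g"
    using Suc.prems ksmooth_mono le_SucI by blast+
  then have "ksmooth n (partial i (\<lambda>x. f x * g x))" for i
    unfolding partial_mult[OF d] using Suc.prems
    by (intro ksmooth_add Suc.IH) (auto simp: ksmooth_Suc)
  with d show ?case by (simp add: ksmooth_Suc differentiable_mult)
qed (simp add: ksmooth_0 differentiable_mult)

lemma smooth_mult:
  fixes f g :: "real^('d::finite) \<Rightarrow> 'b::real_normed_algebra"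
  shows "smooth f \<Longrightarrow> smooth g \<Longrightarrow> smooth (\<lambda>x. f x * g x)"
  by (simp add: smooth_iff_ksmooth ksmooth_mult)

lemma partial_component:
  fixes \<phi> :: "real^('d::finite) \<Rightarrow> real^('e::finite)"
  assumes "smooth \<phi>"
  shows "partial i (\<lambda>x. of_real (\<phi> x $ j)) = (\<lambda>x. of_real (partial i \<phi> x $ j) :: 'b::real_normed_algebra_1)"
  using partials_bounded_linear[OF bounded_linear_compose[OF bounded_linear_of_real
    bounded_linear_vec_nth] assms, of "[i]" j] by simp

lemma smooth_component:
  fixes \<phi> :: "real^('d::finite) \<Rightarrow> real^('e::finite)"
  assumes "smooth \<phi>"
  shows "smooth (\<lambda>x. of_real (\<phi> x $ j) :: 'b::real_normed_algebra_1)"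
  using smooth_bounded_linear[OF bounded_linear_compose[OF bounded_linear_of_real
    bounded_linear_vec_nth] assms, of j] by simp

text \<open>The inner derivatives are taken of the components embedded into the target algebra, so
  that the right side is a sum of products in one algebra, ready for the sum and product
  lemmas.\<close>

lemma partial_compose:
  fixes \<phi> :: "real^('d::finite) \<Rightarrow> real^('e::finite)" and f :: "real^'e \<Rightarrow> 'b::real_normed_algebra_1"
  assumes "smooth \<phi>" "smooth f"
  shows "partial i (\<lambda>x. f (\<phi> x)) =
    (\<lambda>x. \<Sum>j\<in>UNIV. partial i (\<lambda>x. of_real (\<phi> x $ j)) x * partial j f (\<phi> x))"
proof
  fix x
  let ?D = "frechet_derivative f (at (\<phi> x))" and ?E = "frechet_derivative \<phi> (at x)"
  have D: "(f has_derivative ?D) (at (\<phi> x))"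
    by (rule has_derivative_smooth[OF assms(2)])
  have "partial i (\<lambda>x. f (\<phi> x)) x = ?D (partial i \<phi> x)"
    using partial_eqI[OF has_derivative_compose[OF has_derivative_smooth[OF assms(1)] D]]
    by (simp add: partial_def[of i \<phi>])
  also have "partial i \<phi> x = (\<Sum>j\<in>UNIV. (partial i \<phi> x $ j) *\<^sub>R axis j 1)"
    using basis_expansion[of "partial i \<phi> x"] by (simp add: scalar_mult_eq_scaleR)
  also have "?D \<dots> = (\<Sum>j\<in>UNIV. (partial i \<phi> x $ j) *\<^sub>R partial j f (\<phi> x))"
    using has_derivative_linear[OF D] by (simp add: linear_sum linear_cmul partial_def)
  finally show "partial i (\<lambda>x. f (\<phi> x)) x =
      (\<Sum>j\<in>UNIV. partial i (\<lambda>x. of_real (\<phi> x $ j)) x * partial j f (\<phi> x))"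
    by (simp add: partial_component[OF assms(1)] scaleR_conv_of_real)
qed

lemma smooth_compose:
  fixes \<phi> :: "real^('d::finite) \<Rightarrow> real^('e::finite)" and f :: "real^'e \<Rightarrow> 'b::real_normed_algebra_1"
  assumes "smooth \<phi>" "smooth f"
  shows "smooth (\<lambda>x. f (\<phi> x))"
proof -
  have d: "(\<lambda>x. f (\<phi> x)) differentiable (at x)" if "smooth f" for x and f :: "real^'e \<Rightarrow> 'b"
    using has_derivative_compose[OF has_derivative_smooth[OF assms(1)] has_derivative_smooth[OF that]]
    by (auto simp: differentiable_def)
  have "ksmooth n (\<lambda>x. f (\<phi> x))" for n
    using assms(2)
  proof (induction n arbitrary: f)
    case (Suc n)
    have "ksmooth n (partial i (\<lambda>x. f (\<phi> x)))" for i
      unfolding partial_compose[OF assms(1) Suc.prems]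
      using smooth_partial[OF smooth_component[OF assms(1), where 'b = 'b], unfolded smooth_iff_ksmooth]
      by (intro ksmooth_sum ksmooth_mult Suc.IH smooth_partial Suc.prems) auto
    then show ?case by (simp add: ksmooth_Suc d[OF Suc.prems])
  qed (simp add: ksmooth_0 d)
  then show ?thesis by (simp add: smooth_iff_ksmooth)
qed

text \<open>The outer function lives on \<open>real\<close>, where \<open>smooth\<close> is not
  defined; the tower \<open>H\<close> of its successive derivatives takes the place of
  smoothness.\<close>

lemma smooth_compose_derivs:
  fixes u :: "real^('d::finite) \<Rightarrow> real" and H :: "nat \<Rightarrow> real \<Rightarrow> real"
  assumes "smooth u" "\<And>k t. (H k has_real_derivative H (Suc k) t) (at t)"
  shows "smooth (\<lambda>x. H k (u x))"
proof -
  have D: "((\<lambda>x. H k (u x)) has_derivative (\<lambda>h. H (Suc k) (u x) * frechet_derivative u (at x) h)) (at x)" for k x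
    using has_derivative_compose[OF has_derivative_smooth[OF assms(1)]
        assms(2)[unfolded has_field_derivative_def]] .
  have P: "partial i (\<lambda>x. H k (u x)) = (\<lambda>x. H (Suc k) (u x) * partial i u x)" for i k
    using partial_eqI[OF D] by (simp add: fun_eq_iff partial_def[of _ u])
  have d: "(\<lambda>x. H k (u x)) differentiable (at x)" for x k
    using D by (auto simp: differentiable_def)
  have "ksmooth n (\<lambda>x. H k (u x))" for n k
  proof (induction n arbitrary: k)
    case (Suc n)
    have "ksmooth n (partial i (\<lambda>x. H k (u x)))" for i
      unfolding P using smooth_partial[OF assms(1)]
      by (intro ksmooth_mult Suc.IH) (simp add: smooth_iff_ksmooth)
    then show ?case by (simp add: ksmooth_Suc d)
  qed (simp add: ksmooth_0 d)
  then show ?thesis by (simp add: smooth_iff_ksmooth)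
qed

lemma smooth_ident: "smooth (\<lambda>x. x)"
proof -
  have "partial i (\<lambda>x. x) = (\<lambda>x. axis i 1)" for i :: 'a
    by (rule ext) (simp add: partial_def)
  then show ?thesis by (simp add: smooth_iff_partial)
qed

lemma partials_shift:
  assumes "smooth f"
  shows "partials is (\<lambda>x. f (x - a)) = (\<lambda>x. partials is f (x - a))"
proof (induction "is")
  case (Cons i "is")
  have "((\<lambda>x. partials is f (x - a)) has_derivative
      (\<lambda>h. frechet_derivative (partials is f) (at (x - a)) h)) (at x)" for x
    by (rule has_derivative_compose[of "\<lambda>x. x - a", OF _ has_derivative_smooth[OF smooth_partials[OF assms]]])
      (auto intro!: derivative_eq_intros)
  then have "partial i (\<lambda>x. partials is f (x - a)) x = partial i (partials is f) (x - a)" for x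
    unfolding partial_def[of i "partials is f"] by (rule partial_eqI)
  with Cons show ?case by simp
qed simp

lemma smooth_shift:
  assumes "smooth f"
  shows "smooth (\<lambda>x. f (x - a))"
  unfolding smooth_def partials_shift[OF assms]
proof (intro allI)
  fix "is" x
  have "(partials is f) \<circ> (\<lambda>x. x - a) differentiable (at x)"
    by (intro differentiable_chain_at smoothD smooth_partials assms derivative_intros)
  then show "(\<lambda>x. partials is f (x - a)) differentiable (at x)" by (simp add: o_def)
qed

lemma smooth_cong_open:
  assumes "\<And>x. \<exists>S g. open S \<and> x \<in> S \<and> smooth g \<and> (\<forall>y\<in>S. f y = g y)"
  shows "smooth f"
  unfolding smooth_def
proof (intro allI)
  fix "is" x
  obtain S g where S: "open S" "x \<in> S" "smooth g" "\<forall>y\<in>S. f y = g y" using assms by blast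
  have "partials is f y = partials is g y" if "y \<in> S" for y
    by (rule partials_cong_open[OF S(1) _ that]) (use S in blast)
  moreover obtain D where "(partials is g has_derivative D) (at x)"
    using S(3) unfolding smooth_def differentiable_def by blast
  ultimately have "(partials is f has_derivative D) (at x)"
    using has_derivative_transform_within_open[OF _ S(1,2)] by metis
  then show "partials is f differentiable (at x)" by (auto simp: differentiable_def)
qed

section \<open>Smooth bump functions\<close>

text \<open>The functions \<open>p(1/t) exp(-1/t)\<close>, extended by zero, are closed under differentiation.\<close>

definition flat :: "real poly \<Rightarrow> real \<Rightarrow> real"
  where "flat p t = (if t > 0 then poly p (1 / t) * exp (- 1 / t) else 0)"

lemma tendsto_poly_times_exp_minus: "((\<lambda>s::real. poly p s * exp (- s)) \<longlongrightarrow> 0) at_top"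
proof -
  have "((\<lambda>s::real. \<Sum>i\<le>degree p. coeff p i * (s ^ i / exp s)) \<longlongrightarrow> (\<Sum>i\<le>degree p. coeff p i * 0)) at_top"
    by (intro tendsto_intros tendsto_power_div_exp_0)
  then show ?thesis
    by (simp add: poly_altdef sum_distrib_right exp_minus divide_inverse mult.assoc)
qed

text \<open>For t > 0 the derivative of p(1/t) exp(-1/t) is (1/t^2) (p - p')(1/t) exp(-1/t), and the
  factor 1/t^2 is the polynomial \<open>[:0, 0, 1:]\<close> at 1/t.\<close>

lemma flat_has_real_derivative:
  "(flat p has_real_derivative flat ([:0, 0, 1:] * (p - pderiv p)) t) (at t)"
proof -
  consider "t > 0" | "t < 0" | "t = 0" by linarith
  then show ?thesis
  proof cases
    case 1
    have "((\<lambda>t. poly p (1 / t) * exp (- 1 / t)) has_real_derivative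
        flat ([:0, 0, 1:] * (p - pderiv p)) t) (at t)"
    proof -
      have "((\<lambda>t. poly p (1 / t)) has_real_derivative poly (pderiv p) (1 / t) * (- (1 / t\<^sup>2))) (at t)"
        using 1 by (intro DERIV_chain2[OF poly_DERIV])
          (auto intro!: derivative_eq_intros simp: power2_eq_square)
      moreover have "((\<lambda>t. exp (- 1 / t)) has_real_derivative exp (- 1 / t) * (1 / t\<^sup>2)) (at t)"
        using 1 by (auto intro!: derivative_eq_intros simp: power2_eq_square)
      ultimately have "((\<lambda>t. poly p (1 / t) * exp (- 1 / t)) has_real_derivative
         poly (pderiv p) (1 / t) * (- (1 / t\<^sup>2)) * exp (- 1 / t) + exp (- 1 / t) * (1 / t\<^sup>2) * poly p (1 / t)) (at t)"
        by (rule DERIV_mult)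
      then show ?thesis
        using 1 by (simp add: flat_def algebra_simps power2_eq_square)
    qed
    then show ?thesis
      by (rule has_field_derivative_transform_within_open[where S = "{0<..}"])
        (use 1 in \<open>auto simp: flat_def\<close>)
  next
    case 2
    have "((\<lambda>t. 0) has_real_derivative flat ([:0, 0, 1:] * (p - pderiv p)) t) (at t)"
      using 2 by (simp add: flat_def)
    then show ?thesis
      by (rule has_field_derivative_transform_within_open[where S = "{..<0}"])
        (use 2 in \<open>auto simp: flat_def\<close>)
  next
    case 3
    have "((\<lambda>h. flat p h / h) \<longlongrightarrow> 0) (at_right 0)"
    proof -
      \<comment> \<open>With s = 1/h the right difference quotient at 0 becomes s p(s) exp(-s),
        where s tends to infinity.\<close>
      have "((\<lambda>h. poly ([:0, 1:] * p) (inverse h) * exp (- inverse h)) \<longlongrightarrow> 0) (at_right 0)"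
        by (rule filterlim_compose[OF tendsto_poly_times_exp_minus filterlim_inverse_at_top_right])
      moreover have "\<forall>\<^sub>F h in at_right 0.
          poly ([:0, 1:] * p) (inverse h) * exp (- inverse h) = flat p h / h"
        using eventually_at_right_less[of 0] by eventually_elim (simp add: flat_def divide_inverse)
      ultimately show ?thesis by (simp add: tendsto_cong)
    qed
    moreover have "((\<lambda>h. flat p h / h) \<longlongrightarrow> 0) (at_left 0)"
    proof -
      have "\<forall>\<^sub>F h in at_left 0. 0 = flat p h / h"
        unfolding eventually_at_filter by (simp add: flat_def)
      then show ?thesis by (rule tendsto_cong[THEN iffD1]) simp
    qed
    ultimately have "((\<lambda>h. flat p h / h) \<longlongrightarrow> 0) (at 0)"
      by (simp add: filterlim_at_split)
    with 3 show ?thesis by (simp add: DERIV_def flat_def)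
  qed
qed

lemma smooth_flat_compose:
  assumes "smooth u"
  shows "smooth (\<lambda>x. flat 1 (u x))"
proof -
  define H where "H k = flat (((\<lambda>p. [:0, 0, 1:] * (p - pderiv p)) ^^ k) 1)" for k
  have "(H k has_real_derivative H (Suc k) t) (at t)" for k t
    using flat_has_real_derivative by (simp add: H_def)
  from smooth_compose_derivs[where H = H and k = 0, OF assms this] show ?thesis by (simp add: H_def)
qed

lemma smooth_norm_square: "smooth (\<lambda>x :: real^('d::finite). (norm x)\<^sup>2)"
proof -
  have "smooth (\<lambda>x :: real^'d. \<Sum>i\<in>UNIV. (x $ i) * (x $ i))"
    using smooth_component[OF smooth_ident, where 'b = real] by (intro smooth_sum smooth_mult) auto
  then show ?thesis by (simp add: power2_norm_eq_inner inner_vec_def)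
qed

lemma smooth_bump:
  obtains \<eta> :: "real^('d::finite) \<Rightarrow> complex"
  where "smooth \<eta>" "\<And>y. norm y \<le> 1 \<Longrightarrow> \<eta> y = 1" "\<And>y. norm y \<ge> 2 \<Longrightarrow> \<eta> y = 0"
proof -
  \<comment> \<open>\<open>flat 1\<close> vanishes on the negatives, so \<open>v = 1\<close> on the unit ball; it is at least \<open>exp (- 1)\<close> from \<open>1\<close> on,
    so \<open>v \<le> 0\<close> far out. No quotient of smooth functions is needed.\<close>
  define v :: "real^'d \<Rightarrow> real" where "v y = 1 + - exp 1 * flat 1 ((norm y)\<^sup>2 + - 1)" for y
  \<comment> \<open>Since \<open>flat 1 1\<close> is exp(-1), the factor \<open>exp 1\<close>
    normalises the value to 1 where \<open>v\<close> is 1.\<close>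
  define \<eta> :: "real^'d \<Rightarrow> complex" where "\<eta> y = of_real (exp 1 * flat 1 (v y))" for y
  have "smooth v"
    unfolding v_def by (intro smooth_add smooth_mult smooth_const smooth_flat_compose smooth_norm_square)
  then have "smooth \<eta>"
    unfolding \<eta>_def
    by (intro smooth_bounded_linear[OF bounded_linear_of_real] smooth_mult smooth_const smooth_flat_compose)
  moreover have "\<eta> y = 1" if "norm y \<le> 1" for y
  proof -
    have "(norm y)\<^sup>2 \<le> 1" using that by (simp add: power_le_one)
    then show ?thesis by (simp add: \<eta>_def v_def flat_def flip: exp_add)
  qed
  moreover have "\<eta> y = 0" if "norm y \<ge> 2" for y
  proof -
    have "(norm y)\<^sup>2 \<ge> 2\<^sup>2" using that by (intro power_mono) auto
    then have "exp (- 1) \<le> flat 1 ((norm y)\<^sup>2 + - 1)"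
      by (simp add: flat_def)
    then have "exp 1 * exp (- 1) \<le> exp 1 * flat 1 ((norm y)\<^sup>2 + - 1)"
      by (intro mult_left_mono) auto
    then have "v y \<le> 0" by (simp add: v_def flip: exp_add)
    then show ?thesis by (simp add: \<eta>_def flat_def)
  qed
  ultimately show thesis using that by blast
qed

section \<open>Growth relative to a map\<close>

text \<open>The theorem asks derivatives of \<phi> to be \<open>moderate\<close> and those of \<psi>
  to be \<open>rapid\<close>; the rapid functions form a module over the moderate ones. Natural
  exponents make sums and maxima of exponents easy; real ones return only at the end. The reference
  map has its own target type, so the zero map and the identity can also serve.\<close>

definition moderate :: "('a \<Rightarrow> 'c::real_normed_vector) \<Rightarrow> ('a \<Rightarrow> 'b::real_normed_vector) \<Rightarrow> bool"
  where "moderate \<phi> u \<longleftrightarrow> (\<exists>(q::nat) C. \<forall>x. norm (u x) \<le> C * (1 + norm (\<phi> x)) ^ q)"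

definition rapid :: "('a::real_normed_vector \<Rightarrow> 'c::real_normed_vector) \<Rightarrow> ('a \<Rightarrow> 'b::real_normed_vector) \<Rightarrow> bool"
  where "rapid \<phi> u \<longleftrightarrow> (\<forall>p::nat. moderate \<phi> (\<lambda>x. (1 + norm x) ^ p *\<^sub>R u x))"

lemma moderateI: "(\<And>x. norm (u x) \<le> C * (1 + norm (\<phi> x)) ^ q) \<Longrightarrow> moderate \<phi> u"
  unfolding moderate_def by blast

text \<open>As 1 + |\<phi>| is at least 1, a bound persists for larger exponents; two bounds can
  thus be brought to a common one.\<close>

lemma moderateE:
  assumes "moderate \<phi> u"
  obtains q C where "C \<ge> 0" "\<And>q' x. q' \<ge> q \<Longrightarrow> norm (u x) \<le> C * (1 + norm (\<phi> x)) ^ q'"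
proof -
  obtain q C where qC: "\<And>x. norm (u x) \<le> C * (1 + norm (\<phi> x)) ^ q"
    using assms unfolding moderate_def by blast
  have "norm (u x) \<le> \<bar>C\<bar> * (1 + norm (\<phi> x)) ^ q'" if "q' \<ge> q" for q' x
  proof -
    have "norm (u x) \<le> C * (1 + norm (\<phi> x)) ^ q" by (rule qC)
    also have "\<dots> \<le> \<bar>C\<bar> * (1 + norm (\<phi> x)) ^ q'"
      using that by (intro mult_mono power_increasing) auto
    finally show ?thesis .
  qed
  then show thesis using that[of "\<bar>C\<bar>" q] by auto
qed

lemma moderate_bound:
  assumes "moderate \<phi> u"
  obtains q C where "C \<ge> 0" "\<And>x. norm (u x) \<le> C * (1 + norm (\<phi> x)) ^ q"
  by (rule moderateE[OF assms]) blast

lemma moderate_dominated: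
  assumes "moderate \<phi> u" "\<And>x. norm (v x) \<le> norm (u x)"
  shows "moderate \<phi> v"
  using assms unfolding moderate_def by (meson order_trans)

lemma moderate_add:
  assumes "moderate \<phi> u" "moderate \<phi> v"
  shows "moderate \<phi> (\<lambda>x. u x + v x)"
proof -
  obtain q C where u: "\<And>q' x. q' \<ge> q \<Longrightarrow> norm (u x) \<le> C * (1 + norm (\<phi> x)) ^ q'"
    using moderateE[OF assms(1)] by metis
  obtain r D where v: "\<And>q' x. q' \<ge> r \<Longrightarrow> norm (v x) \<le> D * (1 + norm (\<phi> x)) ^ q'"
    using moderateE[OF assms(2)] by metis
  have "norm (u x + v x) \<le> (C + D) * (1 + norm (\<phi> x)) ^ (max q r)" for x
    using u[of "max q r" x] v[of "max q r" x] norm_triangle_ineq[of "u x" "v x"]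
    by (simp add: distrib_right)
  then show ?thesis by (rule moderateI)
qed

lemma moderate_mult:
  fixes u v :: "'a \<Rightarrow> 'b::real_normed_algebra"
  assumes "moderate \<phi> u" "moderate \<phi> v"
  shows "moderate \<phi> (\<lambda>x. u x * v x)"
proof -
  obtain q C where u: "C \<ge> 0" "\<And>q' x. q' \<ge> q \<Longrightarrow> norm (u x) \<le> C * (1 + norm (\<phi> x)) ^ q'"
    using moderateE[OF assms(1)] by metis
  obtain r D where v: "D \<ge> 0" "\<And>q' x. q' \<ge> r \<Longrightarrow> norm (v x) \<le> D * (1 + norm (\<phi> x)) ^ q'"
    using moderateE[OF assms(2)] by metis
  have "norm (u x * v x) \<le> (C * D) * (1 + norm (\<phi> x)) ^ (q + r)" for x
  proof -
    have "norm (u x * v x) \<le> norm (u x) * norm (v x)" by (rule norm_mult_ineq)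
    also have "\<dots> \<le> (C * (1 + norm (\<phi> x)) ^ q) * (D * (1 + norm (\<phi> x)) ^ r)"
      using u v by (intro mult_mono) auto
    finally show ?thesis by (simp add: power_add mult_ac)
  qed
  then show ?thesis by (rule moderateI)
qed

lemma rapid_add:
  assumes "rapid \<phi> u" "rapid \<phi> v"
  shows "rapid \<phi> (\<lambda>x. u x + v x)"
  unfolding rapid_def scaleR_add_right
  using assms by (intro allI moderate_add) (auto simp: rapid_def)

lemma rapid_minus:
  assumes "rapid \<phi> u"
  shows "rapid \<phi> (\<lambda>x. - u x)"
  unfolding rapid_def
proof
  fix p
  have "moderate \<phi> (\<lambda>x. (1 + norm x) ^ p *\<^sub>R u x)"
    using assms by (simp add: rapid_def)
  then show "moderate \<phi> (\<lambda>x. (1 + norm x) ^ p *\<^sub>R - u x)"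
    by (rule moderate_dominated) simp
qed

lemma rapid_zero: "rapid \<phi> (\<lambda>x. 0)"
  by (auto simp: rapid_def intro: moderateI[of _ 0 _ 0])

lemma rapid_sum:
  "finite A \<Longrightarrow> (\<And>a. a \<in> A \<Longrightarrow> rapid \<phi> (u a)) \<Longrightarrow> rapid \<phi> (\<lambda>x. \<Sum>a\<in>A. u a x)"
  by (induction A rule: finite_induct) (auto intro: rapid_add simp: rapid_zero)

lemma rapid_mult_moderate:
  fixes u v :: "'a::real_normed_vector \<Rightarrow> 'b::real_normed_algebra"
  assumes "rapid \<phi> u" "moderate \<phi> v"
  shows "rapid \<phi> (\<lambda>x. u x * v x)"
  unfolding rapid_def
proof
  fix p
  have "moderate \<phi> (\<lambda>x. ((1 + norm x) ^ p *\<^sub>R u x) * v x)"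
    using assms by (intro moderate_mult) (auto simp: rapid_def)
  then show "moderate \<phi> (\<lambda>x. (1 + norm x) ^ p *\<^sub>R (u x * v x))" by simp
qed

text \<open>Relative to the zero map, \<open>rapid\<close> is the decay condition of the Schwartz space.\<close>

lemma rapid_zero_iff:
  "rapid (\<lambda>x. 0::real) u \<longleftrightarrow> (\<forall>p. \<exists>C. \<forall>x. (1 + norm x) ^ p * norm (u x) \<le> C)"
  by (simp add: rapid_def moderate_def)

lemma schwartz_iff:
  "f \<in> schwartz \<longleftrightarrow> smooth f \<and> (\<forall>is. rapid (\<lambda>x. 0::real) (partials is f))"
proof -
  have bdd: "bdd_above (range g) \<longleftrightarrow> (\<exists>C. \<forall>x. g x \<le> C)" for g :: "real^'a \<Rightarrow> real"
    by (auto simp: bdd_above_def)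
  have "(\<forall>(k::nat) \<alpha>. P k (mderiv \<alpha> f)) \<longleftrightarrow> (\<forall>is k. P k (partials is f))" if "smooth f" for P
  proof
    assume "\<forall>k \<alpha>. P k (mderiv \<alpha> f)"
    then show "\<forall>is k. P k (partials is f)" by (simp add: partials_eq_mderiv[OF that])
  next
    assume "\<forall>is k. P k (partials is f)"
    then show "\<forall>k \<alpha>. P k (mderiv \<alpha> f)" by (simp add: mderiv_def)
  qed
  then show ?thesis
    unfolding schwartz_def rapid_zero_iff bdd mem_Collect_eq by (intro conj_cong refl)
qed

section \<open>The Leibniz rule for classes of functions\<close>

text \<open>A Leibniz rule without binomial coefficients: only closure of \<open>P\<close> under
  sums and under multiplication by members of \<open>Q\<close> matters, so each step of the
  induction needs just the product rule.\<close>

lemma partials_mult_closed: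
  fixes u v :: "real^('d::finite) \<Rightarrow> 'b::real_normed_algebra"
  assumes "smooth u" "smooth v"
    and "\<And>js. length js \<le> length is \<Longrightarrow> P (partials js u)"
    and "\<And>js. length js \<le> length is \<Longrightarrow> Q (partials js v)"
    and mult: "\<And>a b. P a \<Longrightarrow> Q b \<Longrightarrow> P (\<lambda>x. a x * b x)"
    and add: "\<And>a b. P a \<Longrightarrow> P b \<Longrightarrow> P (\<lambda>x. a x + b x)"
  shows "P (partials is (\<lambda>x. u x * v x))"
  using assms(1-4)
proof (induction "is" arbitrary: u v rule: rev_induct)
  case Nil
  from Nil(3)[of "[]"] Nil(4)[of "[]"] show ?case by (simp add: mult)
next
  case (snoc i "is")
  have u: "P (partials js (partial i u))" if "length js \<le> length is" for js
    using snoc.prems(3)[of "js @ [i]"] that by (simp add: partials_append)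
  have v: "Q (partials js (partial i v))" if "length js \<le> length is" for js
    using snoc.prems(4)[of "js @ [i]"] that by (simp add: partials_append)
  have "P (partials is (\<lambda>x. u x * partial i v x))"
    by (rule snoc.IH[OF snoc.prems(1) smooth_partial[OF snoc.prems(2)] snoc.prems(3) v]) simp_all
  moreover have "P (partials is (\<lambda>x. partial i u x * v x))"
    by (rule snoc.IH[OF smooth_partial[OF snoc.prems(1)] snoc.prems(2) u snoc.prems(4)]) simp_all
  ultimately have "P (\<lambda>x. partials is (\<lambda>x. u x * partial i v x) x + partials is (\<lambda>x. partial i u x * v x) x)"
    by (rule add)
  moreover have "partials (is @ [i]) (\<lambda>x. u x * v x) =
      (\<lambda>x. partials is (\<lambda>x. u x * partial i v x) x + partials is (\<lambda>x. partial i u x * v x) x)"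
    using snoc.prems(1,2)
    by (simp add: partials_append partial_mult smoothD partials_add smooth_mult smooth_partial)
  ultimately show ?case by simp
qed

text \<open>Once the term with all derivatives on v is subtracted, the remaining Leibniz terms carry
  derivatives of v of strictly smaller order. Hence \<open>Q\<close> is required of shorter lists
  only, which permits an induction on the order.\<close>

lemma partials_mult_commutator:
  fixes u v :: "real^('d::finite) \<Rightarrow> 'b::real_normed_algebra"
  assumes "smooth u" "smooth v"
    and "\<And>js. P (partials js u)"
    and "\<And>js. length js < length is \<Longrightarrow> Q (partials js v)"
    and mult: "\<And>a b. P a \<Longrightarrow> Q b \<Longrightarrow> P (\<lambda>x. a x * b x)"
    and add: "\<And>a b. P a \<Longrightarrow> P b \<Longrightarrow> P (\<lambda>x. a x + b x)"
    and zero: "P (\<lambda>x. 0)"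
  shows "P (\<lambda>x. partials is (\<lambda>x. u x * v x) x - u x * partials is v x)"
  using assms(1-4)
proof (induction "is" arbitrary: v rule: rev_induct)
  case Nil
  then show ?case by (simp add: zero)
next
  case (snoc i "is")
  have u: "P (partials js (partial i u))" for js
    using snoc.prems(3)[of "js @ [i]"] by (simp add: partials_append)
  have v: "Q (partials js (partial i v))" if "length js < length is" for js
    using snoc.prems(4)[of "js @ [i]"] that by (simp add: partials_append)
  have "P (\<lambda>x. partials is (\<lambda>x. u x * partial i v x) x - u x * partials is (partial i v) x)"
    by (rule snoc.IH[OF snoc.prems(1) smooth_partial[OF snoc.prems(2)] snoc.prems(3) v])
  moreover have "P (partials is (\<lambda>x. partial i u x * v x))"
    by (rule partials_mult_closed[where P = P and Q = Q,
          OF smooth_partial[OF snoc.prems(1)] snoc.prems(2) u snoc.prems(4)])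
      (simp_all add: mult add)
  ultimately have "P (\<lambda>x. (partials is (\<lambda>x. u x * partial i v x) x - u x * partials is (partial i v) x)
      + partials is (\<lambda>x. partial i u x * v x) x)"
    by (rule add)
  moreover have "partials (is @ [i]) (\<lambda>x. u x * v x) =
      (\<lambda>x. partials is (\<lambda>x. u x * partial i v x) x + partials is (\<lambda>x. partial i u x * v x) x)"
    using snoc.prems(1,2)
    by (simp add: partials_append partial_mult smoothD partials_add smooth_mult smooth_partial)
  ultimately show ?case by (simp add: partials_append algebra_simps)
qed

section \<open>Gliding humps and the bounds on the multiplier\<close>

lemma bump_partials_bounded:
  fixes \<eta> :: "real^('d::finite) \<Rightarrow> complex"
  assumes "smooth \<eta>" "\<And>y. norm y \<ge> 2 \<Longrightarrow> \<eta> y = 0"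
  obtains C where "\<And>y. norm (partials is \<eta> y) \<le> C"
proof -
  have "compact (partials is \<eta> ` cball 0 2)"
    by (intro compact_continuous_image smooth_continuous_on smooth_partials assms compact_cball)
  then obtain C where C: "\<And>y. norm y \<le> 2 \<Longrightarrow> norm (partials is \<eta> y) \<le> C"
    by (metis bounded_iff compact_imp_bounded imageI mem_cball_0)
  have "partials is \<eta> y = 0" if "norm y > 2" for y
    using partials_cong_open[of "- cball 0 2" \<eta> "\<lambda>x. 0" y "is"] that assms(2)
    by (simp add: partials_zero open_Compl)
  then have "norm (partials is \<eta> y) \<le> max C 0" for y
    using C[of y] by (cases "norm y \<le> 2") (simp_all add: le_max_iff_disj)
  then show thesis using that by blast
qed

text \<open>A gap of 6 between the norms keeps the balls of radius 3 about the centres disjoint, and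
  the exponent n in the heights eventually exceeds every fixed power.\<close>

lemma schwartz_hump_sequence:
  fixes y :: "nat \<Rightarrow> real^('d::finite)"
  assumes gap: "\<And>n. norm (y n) + 6 \<le> norm (y (Suc n))"
  obtains f where "f \<in> schwartz"
    "\<And>n z. z \<in> ball (y n) 1 \<Longrightarrow> f z = of_real (1 / (1 + norm (y n)) ^ n)"
proof -
  obtain \<eta> :: "real^'d \<Rightarrow> complex" where \<eta>: "smooth \<eta>"
    "\<And>y. norm y \<le> 1 \<Longrightarrow> \<eta> y = 1" "\<And>y. norm y \<ge> 2 \<Longrightarrow> \<eta> y = 0"
    using smooth_bump by blast
  define c where "c n = complex_of_real (1 / (1 + norm (y n)) ^ n)" for n
  define h where "h n z = c n * \<eta> (z - y n)" for n z
  \<comment> \<open>At most one centre lies within 3 of z, so the relevant bump is selected and no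
    series has to be differentiated.\<close>
  define f where "f z = (if \<exists>n. dist z (y n) < 3 then h (THE n. dist z (y n) < 3) z else 0)" for z
  have mono: "norm (y m) + 6 \<le> norm (y n)" if "m < n" for m n
    using that
  proof (induction n)
    case (Suc n)
    then show ?case using gap[of n] by (cases "m = n") auto
  qed simp
  have sep: "m = n" if "dist z (y m) < 3" "dist z (y n) < 3" for m n z
  proof (rule ccontr)
    assume "m \<noteq> n"
    then have "\<bar>norm (y m) - norm (y n)\<bar> \<ge> 6"
      using mono[of m n] mono[of n m] by linarith
    moreover have "\<bar>norm (y m) - norm (y n)\<bar> \<le> dist (y m) (y n)"
      by (simp add: dist_norm norm_triangle_ineq3)
    moreover have "dist (y m) (y n) < 6"
      using that dist_triangle3[of "y m" "y n" z] by linarith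
    ultimately show False by linarith
  qed
  have f_near: "f z = h n z" if "dist z (y n) < 3" for n z
  proof -
    have "(THE m. dist z (y m) < 3) = n" using sep that by blast
    then show ?thesis using that by (auto simp: f_def)
  qed
  \<comment> \<open>The bumps vanish from radius 2 on. The slack between 2 and 3 leaves a whole unit
    ball free of bumps about any point that is at least 3 away from all centres.\<close>
  have f_far: "f w = 0" if "\<And>n. dist z (y n) \<ge> 3" "dist w z < 1" for z w
  proof (cases "\<exists>n. dist w (y n) < 3")
    case True
    then obtain n where n: "dist w (y n) < 3" by blast
    have "dist w (y n) \<ge> 2"
      using that(1)[of n] that(2) dist_triangle[of z "y n" w] by (simp add: dist_commute)
    then show ?thesis using f_near[OF n] by (simp add: h_def \<eta>(3) dist_norm)
  qed (simp add: f_def)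
  have smooth_h: "smooth (h n)" for n
  unfolding h_def by (rule smooth_mult[OF smooth_const smooth_shift[OF \<eta>(1)]])
  have partials_h: "partials is (h n) z = c n * partials is \<eta> (z - y n)" for "is" n z
    unfolding h_def partials_bounded_linear[OF bounded_linear_mult_right smooth_shift[OF \<eta>(1)]]
      partials_shift[OF \<eta>(1)] ..
  have "smooth f"
  proof (rule smooth_cong_open)
    fix z
    show "\<exists>S g. open S \<and> z \<in> S \<and> smooth g \<and> (\<forall>w\<in>S. f w = g w)"
    proof (cases "\<exists>n. dist z (y n) < 3")
      case True
      then obtain n where "dist z (y n) < 3" by blast
      then show ?thesis using smooth_h f_near
        by (intro exI[of _ "ball (y n) 3"] exI[of _ "h n"]) (auto simp: dist_commute)
    next
      case False
      then show ?thesis using f_far[of z]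
        by (intro exI[of _ "ball z 1"] exI[of _ "\<lambda>x. 0"]) (auto simp: dist_commute not_less)
    qed
  qed
  moreover have "rapid (\<lambda>x. 0::real) (partials is f)" for "is"
    unfolding rapid_zero_iff
  proof
    fix k
    obtain C where C: "\<And>y. norm (partials is \<eta> y) \<le> C"
      using bump_partials_bounded[OF \<eta>(1,3)] by blast
    have C0: "C \<ge> 0" using C[of 0] norm_ge_zero order_trans by blast
    have "(1 + norm z) ^ k * norm (partials is f z) \<le> 4 ^ k * (1 + norm (y k)) ^ k * C" for z
    proof (cases "\<exists>n. dist z (y n) < 3")
      case True
      then obtain n where n: "dist z (y n) < 3" by blast
      have "partials is f z = partials is (h n) z"
        by (rule partials_cong_open[of "ball (y n) 3"]) (use n f_near in \<open>auto simp: dist_commute\<close>)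
      then have "norm (partials is f z) \<le> cmod (c n) * C"
        using C by (simp add: partials_h norm_mult mult_left_mono)
      moreover have "norm z \<le> norm (y n) + 3"
        using n norm_triangle_ineq2[of z "y n"] by (simp add: dist_norm)
      \<comment> \<open>Within distance 3 of the centre, 1 + norm z is at most 4 + norm (y n), hence
        at most 4 (1 + norm (y n)).\<close>
      then have "(1 + norm z) ^ k \<le> (4 * (1 + norm (y n))) ^ k"
        using norm_ge_zero[of "y n"] norm_ge_zero[of z] by (intro power_mono) (simp_all del: norm_ge_zero)
      ultimately have "(1 + norm z) ^ k * norm (partials is f z) \<le>
          (4 * (1 + norm (y n))) ^ k * (cmod (c n) * C)"
        by (intro mult_mono) auto
      also have "\<dots> = 4 ^ k * ((1 + norm (y n)) ^ k * cmod (c n)) * C"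
        unfolding power_mult_distrib by simp
      also have "\<dots> \<le> 4 ^ k * (1 + norm (y k)) ^ k * C"
      proof -
        have cn: "cmod (c n) = 1 / (1 + norm (y n)) ^ n"
          unfolding c_def norm_of_real by simp
        \<comment> \<open>For n \<ge> k the height cancels the weight. The finitely many earlier
          centres are closer to 0 than \<open>y k\<close>, and their heights are at most 1.\<close>
        have "(1 + norm (y n)) ^ k * cmod (c n) \<le> (1 + norm (y k)) ^ k"
        proof (cases "k \<le> n")
          case True
          then have "(1 + norm (y n)) ^ k \<le> (1 + norm (y n)) ^ n"
            by (intro power_increasing) auto
          then have "(1 + norm (y n)) ^ k * cmod (c n) \<le> 1"
            by (simp add: cn divide_le_eq add_pos_nonneg)
          also have "1 \<le> (1 + norm (y k)) ^ k" by (rule one_le_power) simp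
          finally show ?thesis .
        next
          case False
          then have "(1 + norm (y n)) ^ k * cmod (c n) \<le> (1 + norm (y k)) ^ k * 1"
            using mono[of n k] by (intro mult_mono power_mono) (auto simp: cn divide_le_eq add_pos_nonneg)
          then show ?thesis by simp
        qed
        then show ?thesis using C0 by (intro mult_right_mono mult_left_mono) auto
      qed
      finally show ?thesis .
    next
      case False
      have "partials is f z = partials is (\<lambda>x. 0) z"
        by (rule partials_cong_open[of "ball z 1"])
          (use False f_far[of z] in \<open>auto simp: dist_commute not_less\<close>)
      then show ?thesis using C0 by (simp add: partials_zero)
    qed
    then show "\<exists>C. \<forall>x. (1 + norm x) ^ k * norm (partials is f x) \<le> C" by blast
  qed
  ultimately have "f \<in> schwartz" by (simp add: schwartz_iff)
  moreover have "f z = of_real (1 / (1 + norm (y n)) ^ n)" if "z \<in> ball (y n) 1" for n z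
    using that f_near[of z n]
    by (auto simp: h_def c_def \<eta>(2) dist_norm norm_minus_commute)
  ultimately show thesis by (rule that)
qed

text \<open>The constant depends on f but not on x, y or c: it is the Schwartz bound of the single
  image function. The gliding hump needs this uniformity over all centres.\<close>

lemma acts_local_bound:
  fixes \<phi> :: "real^('d::finite) \<Rightarrow> real^'d"
  assumes "smooth \<phi>" "smooth \<psi>" "acts_on_schwartz \<psi> \<phi>" "f \<in> schwartz"
  obtains C where "\<And>x y c. \<phi> x \<in> ball y 1 \<Longrightarrow> (\<And>z. z \<in> ball y 1 \<Longrightarrow> f z = c) \<Longrightarrow>
    (1 + norm x) ^ p * cmod (partials is \<psi> x) * cmod c \<le> C"
proof -
  have "weighted_comp \<psi> \<phi> f \<in> schwartz"
    using assms by (simp add: acts_on_schwartz_def)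
  then obtain C where C: "\<And>x. (1 + norm x) ^ p * cmod (partials is (weighted_comp \<psi> \<phi> f) x) \<le> C"
    unfolding schwartz_iff rapid_zero_iff by meson
  have "(1 + norm x) ^ p * cmod (partials is \<psi> x) * cmod c \<le> C"
    if "\<phi> x \<in> ball y 1" "\<And>z. z \<in> ball y 1 \<Longrightarrow> f z = c" for x y c
  proof -
    have "open (\<phi> -` ball y 1)"
      by (rule open_vimage[OF open_ball smooth_continuous_on[OF assms(1)]])
    then have "partials is (weighted_comp \<psi> \<phi> f) x = partials is (\<lambda>x. \<psi> x * c) x"
      by (rule partials_cong_open) (use that in \<open>auto simp: weighted_comp_def\<close>)
    also have "\<dots> = partials is \<psi> x * c"
      by (simp add: partials_bounded_linear[OF bounded_linear_mult_left assms(2)])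
    finally show ?thesis using C[of x] by (simp add: norm_mult mult.assoc)
  qed
  with that show thesis by blast
qed

lemma schwartz_hump:
  obtains f :: "real^('d::finite) \<Rightarrow> complex"
  where "f \<in> schwartz" "\<And>z. z \<in> ball a 1 \<Longrightarrow> f z = 1"
proof -
  define e :: "real^'d" where "e = axis undefined 1"
  have e: "norm e = 1" by (simp add: e_def)
  \<comment> \<open>The height at index 0 is a zeroth power, hence 1. The other centres only
    complete an admissible sequence, along an arbitrary axis.\<close>
  define y where "y n = (if n = 0 then a else (norm a + 6 * real n) *\<^sub>R e)" for n
  have "norm (y n) + 6 \<le> norm (y (Suc n))" for n
    by (auto simp: y_def e)
  then obtain f where "f \<in> schwartz"
      "\<And>n z. z \<in> ball (y n) 1 \<Longrightarrow> f z = of_real (1 / (1 + norm (y n)) ^ n)"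
    using schwartz_hump_sequence by blast
  from this(1) this(2)[where n = 0] show thesis by (intro that[of f]) (simp_all add: y_def)
qed

text \<open>The set where |\<phi>| \<le> R may be unbounded, so compactness is used in the target:
  finitely many unit balls cover \<open>cball 0 R\<close>, and a Schwartz function equal to 1 on
  such a ball gives the bound on its preimage.\<close>

lemma acts_bounded_on_bounded:
  fixes \<phi> :: "real^('d::finite) \<Rightarrow> real^'d"
  assumes "smooth \<phi>" "smooth \<psi>" "acts_on_schwartz \<psi> \<phi>"
  obtains C where "\<And>x. norm (\<phi> x) \<le> R \<Longrightarrow> (1 + norm x) ^ p * cmod (partials is \<psi> x) \<le> C"
proof -
  have "\<exists>C. \<forall>x. \<phi> x \<in> ball y 1 \<longrightarrow> (1 + norm x) ^ p * cmod (partials is \<psi> x) \<le> C" for y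
  proof -
    obtain f :: "real^'d \<Rightarrow> complex" where f: "f \<in> schwartz" "\<And>z. z \<in> ball y 1 \<Longrightarrow> f z = 1"
      using schwartz_hump by blast
    obtain C where C: "\<And>x y c. \<phi> x \<in> ball y 1 \<Longrightarrow> (\<And>z. z \<in> ball y 1 \<Longrightarrow> f z = c) \<Longrightarrow>
        (1 + norm x) ^ p * cmod (partials is \<psi> x) * cmod c \<le> C"
      using acts_local_bound[OF assms f(1)] by blast
    have "(1 + norm x) ^ p * cmod (partials is \<psi> x) \<le> C" if "\<phi> x \<in> ball y 1" for x
      using C[OF that f(2)] by simp
    then show ?thesis by blast
  qed
  then obtain B where B: "\<And>y x. \<phi> x \<in> ball y 1 \<Longrightarrow> (1 + norm x) ^ p * cmod (partials is \<psi> x) \<le> B y"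
    by metis
  have "cball 0 R \<subseteq> (\<Union>y\<in>cball (0 :: real^'d) R. ball y 1)" by force
  then obtain Y where Y: "Y \<subseteq> cball (0 :: real^'d) R" "finite Y" "cball 0 R \<subseteq> (\<Union>y\<in>Y. ball y 1)"
    by (rule compactE_image[where f = "\<lambda>y. ball y 1", OF compact_cball open_ball])
  have "(1 + norm x) ^ p * cmod (partials is \<psi> x) \<le> Max (B ` Y)" if x: "norm (\<phi> x) \<le> R" for x
  proof -
    have "\<phi> x \<in> cball 0 R" using x by simp
    then obtain y where "y \<in> Y" "\<phi> x \<in> ball y 1" using Y(3) by blast
    then show ?thesis using B[of x y] Y(2) by (meson Max_ge finite_imageI imageI order_trans)
  qed
  then show thesis by (rule that)
qed

text \<open>Gliding hump: were the bound to fail with exponent \<open>n\<close> at points \<open>x\<^sub>n\<close>, a single Schwartz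
  function equal to \<open>(1 + \<bar>\<phi> x\<^sub>n\<bar>)\<^sup>-\<^sup>n\<close> near each \<open>\<phi> x\<^sub>n\<close> would be mapped outside the Schwartz space.\<close>

lemma acts_imp_rapid:
  fixes \<phi> :: "real^('d::finite) \<Rightarrow> real^'d"
  assumes "smooth \<phi>" "smooth \<psi>" "acts_on_schwartz \<psi> \<phi>"
  shows "rapid \<phi> (partials is \<psi>)"
proof (rule ccontr)
  define F where "F p x = (1 + norm x) ^ p * cmod (partials is \<psi> x)" for p x
  assume "\<not> ?thesis"
  then obtain p where p: "\<And>q C. \<exists>x. F p x > C * (1 + norm (\<phi> x)) ^ q"
    unfolding rapid_def moderate_def F_def by (auto simp: not_le)
  \<comment> \<open>Where |\<phi>| \<le> R some constant C suffices, so a failure for the constant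
    \<open>max C (real n)\<close> must occur where |\<phi>| exceeds R.\<close>
  have ex: "\<exists>x. norm (\<phi> x) > R \<and> F p x > real n * (1 + norm (\<phi> x)) ^ n" for n R
  proof (rule ccontr)
    assume neg: "\<not> ?thesis"
    obtain C where C: "\<And>x. norm (\<phi> x) \<le> R \<Longrightarrow> F p x \<le> C"
      using acts_bounded_on_bounded[OF assms] unfolding F_def by metis
    have "F p x \<le> max C (real n) * (1 + norm (\<phi> x)) ^ n" for x
    proof (cases "norm (\<phi> x) \<le> R")
      case True
      then have "F p x \<le> max C (real n) * 1" using C[of x] by simp
      also have "\<dots> \<le> max C (real n) * (1 + norm (\<phi> x)) ^ n"
        by (intro mult_left_mono) (auto simp: max_def)
      finally show ?thesis .
    next
      case False
      then have "F p x \<le> real n * (1 + norm (\<phi> x)) ^ n" using neg by (meson not_le)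
      also have "\<dots> \<le> max C (real n) * (1 + norm (\<phi> x)) ^ n" by (intro mult_right_mono) auto
      finally show ?thesis .
    qed
    with p[of "max C (real n)" n] show False by (meson not_le)
  qed
  \<comment> \<open>Each point is chosen after its predecessor, with \<open>R\<close> six above the
    norm of the previous image.\<close>
  have "\<exists>x. \<forall>n. F p (x n) > real n * (1 + norm (\<phi> (x n))) ^ n \<and> norm (\<phi> (x n)) + 6 \<le> norm (\<phi> (x (Suc n)))"
    by (rule dependent_nat_choice) (use ex in \<open>meson less_imp_le\<close>)+
  then obtain x where x: "\<And>n. F p (x n) > real n * (1 + norm (\<phi> (x n))) ^ n"
      "\<And>n. norm (\<phi> (x n)) + 6 \<le> norm (\<phi> (x (Suc n)))"
    by blast
  obtain f where f: "f \<in> schwartz"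
      "\<And>n z. z \<in> ball (\<phi> (x n)) 1 \<Longrightarrow> f z = of_real (1 / (1 + norm (\<phi> (x n))) ^ n)"
    using schwartz_hump_sequence[of "\<lambda>n. \<phi> (x n)", OF x(2)] by blast
  obtain C where C: "\<And>x y c. \<phi> x \<in> ball y 1 \<Longrightarrow> (\<And>z. z \<in> ball y 1 \<Longrightarrow> f z = c) \<Longrightarrow>
      F p x * cmod c \<le> C"
    using acts_local_bound[OF assms f(1)] unfolding F_def by blast
  \<comment> \<open>The factor \<open>real n\<close> built into the failing bounds now exceeds the
    fixed constant C.\<close>
  obtain n where n: "real n > C" using reals_Archimedean2 by blast
  have "F p (x n) * cmod (of_real (1 / (1 + norm (\<phi> (x n))) ^ n)) \<le> C"
    by (rule C[of "x n" "\<phi> (x n)", OF _ f(2)]) simp_all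
  then have "F p (x n) * (1 / (1 + norm (\<phi> (x n))) ^ n) \<le> C"
    unfolding norm_of_real by simp
  moreover have "(1 + norm (\<phi> (x n))) ^ n > 0" by (simp add: add_pos_nonneg)
  ultimately have "F p (x n) \<le> C * (1 + norm (\<phi> (x n))) ^ n" by (simp add: divide_le_eq)
  also have "\<dots> \<le> real n * (1 + norm (\<phi> (x n))) ^ n"
    using n by (intro mult_right_mono) auto
  finally show False using x(1)[of n] by simp
qed

section \<open>Necessity for the components of the map\<close>

text \<open>On the ball, where small decay gives no information, continuity yields a bound with
  exponent 0.\<close>

lemma moderate_if_outside_cball:
  fixes \<phi> :: "real^('d::finite) \<Rightarrow> 'c::real_normed_vector"
  assumes "continuous_on (cball 0 m) v" "moderate \<phi> (\<lambda>x. if norm x \<ge> m then v x else 0)"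
  shows "moderate \<phi> v"
proof -
  have "compact (v ` cball 0 m)"
    using assms(1) by (intro compact_continuous_image compact_cball)
  then obtain C where C: "\<And>x. norm x \<le> m \<Longrightarrow> norm (v x) \<le> C"
    by (metis bounded_iff compact_imp_bounded imageI mem_cball_0)
  have "moderate \<phi> (\<lambda>x. if norm x \<ge> m then 0 else v x)"
    using order_trans[OF C abs_ge_self] by (intro moderateI[of _ "\<bar>C\<bar>" _ 0]) auto
  from moderate_add[OF assms(2) this] show ?thesis
    by (rule moderate_dominated) simp
qed

text \<open>Outside a ball, 1/|\<psi>| is at most a constant times (1 + |x|)^k (1 + |\<phi>|)^k.
  Rapidity of \<psi> * v with weight exponent k absorbs the first factor; the second raises the
  exponent from q to q + k.\<close>

lemma small_decay_divide:
  fixes \<phi> :: "real^('d::finite) \<Rightarrow> real^'d"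
  assumes "small_decay \<psi> \<phi>" "continuous_on UNIV v" "rapid \<phi> (\<lambda>x. \<psi> x * v x)"
  shows "moderate \<phi> v"
proof -
  obtain m where m: "m > 0" and inf: "(INF x\<in>{x. norm x \<ge> m}.
       (1 + norm x) powr m * (1 + norm (\<phi> x)) powr m * cmod (\<psi> x)) > 0" (is "?I > 0")
    using assms(1) unfolding small_decay_def by blast
  define k where "k = nat \<lceil>m\<rceil>"
  have powr: "(1 + norm a) powr m \<le> (1 + norm a) ^ k" for a :: "real^'d"
  proof -
    have "(1 + norm a) powr m \<le> (1 + norm a) powr real k"
      unfolding k_def using m by (intro powr_mono real_nat_ceiling_ge) auto
    then show ?thesis by (simp add: powr_realpow add_pos_nonneg)
  qed
  have low: "?I \<le> (1 + norm x) ^ k * (1 + norm (\<phi> x)) ^ k * cmod (\<psi> x)" if "norm x \<ge> m" for x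
  proof -
    have "?I \<le> (1 + norm x) powr m * (1 + norm (\<phi> x)) powr m * cmod (\<psi> x)"
      using that by (intro cINF_lower bdd_belowI2[of _ 0]) auto
    also have "\<dots> \<le> (1 + norm x) ^ k * (1 + norm (\<phi> x)) ^ k * cmod (\<psi> x)"
      by (intro mult_right_mono mult_mono powr) auto
    finally show ?thesis .
  qed
  obtain q C where C: "C \<ge> 0" "\<And>x. norm ((1 + norm x) ^ k *\<^sub>R (\<psi> x * v x)) \<le> C * (1 + norm (\<phi> x)) ^ q"
    by (rule moderate_bound[OF assms(3)[unfolded rapid_def, rule_format, of k]], rule that)
  have "cmod (v x) \<le> C / ?I * (1 + norm (\<phi> x)) ^ (q + k)" if "norm x \<ge> m" for x
  proof -
    have "?I * cmod (v x) \<le> ((1 + norm x) ^ k * (1 + norm (\<phi> x)) ^ k * cmod (\<psi> x)) * cmod (v x)"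
      by (intro mult_right_mono low that) auto
    also have "\<dots> = (1 + norm (\<phi> x)) ^ k * norm ((1 + norm x) ^ k *\<^sub>R (\<psi> x * v x))"
      by (simp add: norm_mult)
    also have "\<dots> \<le> (1 + norm (\<phi> x)) ^ k * (C * (1 + norm (\<phi> x)) ^ q)"
      by (intro mult_left_mono C) auto
    finally show ?thesis using inf by (simp add: power_add field_simps)
  qed
  moreover have "0 \<le> C / ?I * (1 + norm (\<phi> x)) ^ (q + k)" for x
    using C(1) inf by (intro mult_nonneg_nonneg divide_nonneg_pos) auto
  ultimately have "moderate \<phi> (\<lambda>x. if norm x \<ge> m then v x else 0)"
    by (intro moderateI[of _ "C / ?I" _ "q + k"]) auto
  moreover have "continuous_on (cball 0 m) v" using assms(2) continuous_on_subset by blast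
  ultimately show ?thesis using moderate_if_outside_cball by blast
qed

lemma norm_component_le: "cmod (of_real (x $ j)) \<le> norm x"
  using component_le_norm_cart[of x j] by simp

lemma moderate_coordinate: "moderate \<phi> (\<lambda>x. complex_of_real (\<phi> x $ j))"
proof (rule moderateI[of _ 1 _ 1])
  show "cmod (of_real (\<phi> x $ j)) \<le> 1 * (1 + norm (\<phi> x)) ^ 1" for x
    using norm_component_le[of "\<phi> x" j] by simp
qed

text \<open>A coordinate and all its derivatives are moderate relative to the identity. Growth of
  order q is paid for by decay of order p + q of the other factor.\<close>

lemma schwartz_mult_coordinate:
  assumes "f \<in> schwartz"
  shows "(\<lambda>x. f x * of_real (x $ j)) \<in> schwartz"
proof -
  let ?v = "\<lambda>x. complex_of_real (x $ j)"
  have v: "smooth ?v" using smooth_component[OF smooth_ident] .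
  have pv: "partial i ?v = (\<lambda>x. of_real (axis i 1 $ j))" for i
    unfolding partial_component[OF smooth_ident] by (simp add: partial_def)
  have "moderate (\<lambda>x. x) (partials is ?v)" for "is"
  proof (cases "is" rule: rev_cases)
    case Nil
    then show ?thesis using moderate_coordinate[of "\<lambda>x. x" j] by simp
  next
    case (snoc js i)
    have "\<exists>c. partials js (\<lambda>x. of_real (axis i 1 $ j)) = (\<lambda>x. c :: complex)"
      by (induction js) auto
    then obtain c where "partials is ?v = (\<lambda>x. c)" by (auto simp: snoc partials_append pv)
    then show ?thesis by (intro moderateI[of _ "norm c" _ 0]) simp
  qed
  moreover have "rapid (\<lambda>x. 0::real) (\<lambda>x. u x * w x)"
    if u: "rapid (\<lambda>x. 0::real) u" and w: "moderate (\<lambda>x. x) w" for u w :: "real^'a \<Rightarrow> complex"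
    unfolding rapid_zero_iff
  proof
    fix p
    obtain q C where C: "C \<ge> 0" "\<And>x. norm (w x) \<le> C * (1 + norm x) ^ q"
      by (rule moderate_bound[OF w], rule that)
    obtain D where D: "\<And>x. (1 + norm x) ^ (p + q) * norm (u x) \<le> D"
      using u unfolding rapid_zero_iff by blast
    have "(1 + norm x) ^ p * norm (u x * w x) \<le> C * D" for x
    proof -
      have "(1 + norm x) ^ p * norm (u x * w x) \<le> (1 + norm x) ^ p * (norm (u x) * (C * (1 + norm x) ^ q))"
        unfolding norm_mult by (intro mult_left_mono C) auto
      also have "\<dots> = C * ((1 + norm x) ^ (p + q) * norm (u x))" by (simp add: power_add)
      also have "\<dots> \<le> C * D" by (intro mult_left_mono C D)
      finally show ?thesis .
    qed
    then show "\<exists>C. \<forall>x. (1 + norm x) ^ p * norm (u x * w x) \<le> C" by blast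
  qed
  ultimately have "rapid (\<lambda>x. 0::real) (partials is (\<lambda>x. f x * ?v x))" for "is"
    using assms v unfolding schwartz_iff
    by (intro partials_mult_closed[where P = "rapid (\<lambda>x. 0::real)" and Q = "moderate (\<lambda>x. x)"] rapid_add) auto
  then show ?thesis using assms v by (simp add: schwartz_iff smooth_mult)
qed

lemma acts_imp_moderate:
  fixes \<phi> :: "real^('d::finite) \<Rightarrow> real^'d"
  assumes "smooth \<phi>" "smooth \<psi>" "small_decay \<psi> \<phi>" "acts_on_schwartz \<psi> \<phi>"
  shows "moderate \<phi> (partials is (\<lambda>x. complex_of_real (\<phi> x $ j)))"
proof (induction "is" rule: length_induct)
  case (1 "is")
  let ?v = "\<lambda>x. complex_of_real (\<phi> x $ j)"
  have v: "smooth ?v" using smooth_component[OF assms(1)] .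
  \<comment> \<open>The product (\<psi> * \<phi>_j) * (f o \<phi>) equals \<psi> times (f * x_j) o
    \<phi>, so the new operator is multiplication by a coordinate followed by the old one.\<close>
  have "acts_on_schwartz (\<lambda>x. \<psi> x * ?v x) \<phi>"
    unfolding acts_on_schwartz_def
  proof
    fix f :: "real^'d \<Rightarrow> complex" assume "f \<in> schwartz"
    then have "weighted_comp \<psi> \<phi> (\<lambda>x. f x * of_real (x $ j)) \<in> schwartz"
      using assms(4) schwartz_mult_coordinate unfolding acts_on_schwartz_def by blast
    then show "weighted_comp (\<lambda>x. \<psi> x * ?v x) \<phi> f \<in> schwartz"
      by (simp add: weighted_comp_def mult_ac)
  qed
  then have "rapid \<phi> (partials is (\<lambda>x. \<psi> x * ?v x))"
    by (intro acts_imp_rapid smooth_mult assms v)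
  \<comment> \<open>The derivatives of \<phi>_j in this difference have order below
    \<open>length is\<close>, so they are moderate by induction; for the empty list the difference
    is 0.\<close>
  moreover have "rapid \<phi> (\<lambda>x. partials is (\<lambda>x. \<psi> x * ?v x) x - \<psi> x * partials is ?v x)"
    using acts_imp_rapid[OF assms(1,2,4)] 1
    by (intro partials_mult_commutator[where P = "rapid \<phi>" and Q = "moderate \<phi>"]
        assms v rapid_mult_moderate rapid_add rapid_zero) auto
  ultimately have "rapid \<phi> (\<lambda>x. partials is (\<lambda>x. \<psi> x * ?v x) x
      + - (partials is (\<lambda>x. \<psi> x * ?v x) x - \<psi> x * partials is ?v x))"
    by (intro rapid_add rapid_minus)
  then have "rapid \<phi> (\<lambda>x. \<psi> x * partials is ?v x)" by simp
  then show ?case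
    by (rule small_decay_divide[OF assms(3) smooth_continuous_on[OF smooth_partials[OF v]]])
qed

section \<open>The chain rule and the equivalence\<close>

lemma schwartz_partial: "f \<in> schwartz \<Longrightarrow> partial i f \<in> schwartz"
  unfolding schwartz_iff by (metis partials_Cons partials_Nil partials_append smooth_partial)

text \<open>The decay of f at \<phi>(x) cancels the growth in 1 + |\<phi>(x)| that rapidity of u
  allows, whatever its exponent.\<close>

lemma rapid_mult_compose_schwartz:
  fixes u :: "real^('d::finite) \<Rightarrow> complex" and \<phi> :: "real^'d \<Rightarrow> real^('e::finite)"
  assumes "rapid \<phi> u" "f \<in> schwartz"
  shows "rapid (\<lambda>x. 0::real) (\<lambda>x. u x * f (\<phi> x))"
  unfolding rapid_zero_iff
proof
  fix p
  obtain q C where C: "C \<ge> 0" "\<And>x. norm ((1 + norm x) ^ p *\<^sub>R u x) \<le> C * (1 + norm (\<phi> x)) ^ q"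
    by (rule moderate_bound[OF assms(1)[unfolded rapid_def, rule_format, of p]], rule that)
  obtain D where D: "\<And>y. (1 + norm y) ^ q * norm (f y) \<le> D"
    using assms(2) unfolding schwartz_iff rapid_zero_iff by (metis partials_Nil)
  have "(1 + norm x) ^ p * norm (u x * f (\<phi> x)) \<le> C * D" for x
  proof -
    have "(1 + norm x) ^ p * norm (u x * f (\<phi> x)) = norm ((1 + norm x) ^ p *\<^sub>R u x) * norm (f (\<phi> x))"
      by (simp add: norm_mult)
    also have "\<dots> \<le> (C * (1 + norm (\<phi> x)) ^ q) * norm (f (\<phi> x))"
      by (intro mult_right_mono C) auto
    also have "\<dots> = C * ((1 + norm (\<phi> x)) ^ q * norm (f (\<phi> x)))" by simp
    also have "\<dots> \<le> C * D" by (intro mult_left_mono C D)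
    finally show ?thesis .
  qed
  then show "\<exists>C. \<forall>x. (1 + norm x) ^ p * norm (u x * f (\<phi> x)) \<le> C" by blast
qed

text \<open>The induction covers all u and f at once: one differentiation yields terms of the same
  shape, with coefficient u * \<partial>_i \<phi>_j or \<partial>_i u, so no higher-order chain rule
  is needed.\<close>

lemma rapid_partials_mult_compose:
  fixes u :: "real^('d::finite) \<Rightarrow> complex" and \<phi> :: "real^'d \<Rightarrow> real^('e::finite)"
  assumes \<phi>: "smooth \<phi>" and mod: "\<And>is j. moderate \<phi> (partials is (\<lambda>x. complex_of_real (\<phi> x $ j)))"
    and "smooth u" "\<And>js. rapid \<phi> (partials js u)" "f \<in> schwartz"
  shows "rapid (\<lambda>x. 0::real) (partials is (\<lambda>x. u x * f (\<phi> x)))"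
  using assms(3-)
proof (induction "is" arbitrary: u f rule: rev_induct)
  case Nil
  then show ?case using rapid_mult_compose_schwartz[of \<phi> u f] Nil(2)[of "[]"] by simp
next
  case (snoc i "is")
  let ?v = "\<lambda>j x. complex_of_real (\<phi> x $ j)"
  let ?w = "\<lambda>j x. u x * partial i (?v j) x"
  have v: "smooth (?v j)" for j using smooth_component[OF \<phi>] .
  have f: "smooth f" using snoc.prems(3) by (simp add: schwartz_iff)
  have w: "smooth (?w j)" for j by (rule smooth_mult[OF snoc.prems(1) smooth_partial[OF v]])
  have rw: "rapid \<phi> (partials js (?w j))" for j js
  proof (rule partials_mult_closed[where P = "rapid \<phi>" and Q = "moderate \<phi>"])
    show "moderate \<phi> (partials ks (partial i (?v j)))" for ks
      using mod[of "ks @ [i]" j] by (simp add: partials_append)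
  qed (use snoc.prems v in \<open>auto intro: rapid_mult_moderate rapid_add smooth_partial\<close>)
  have ru: "rapid \<phi> (partials js (partial i u))" for js
    using snoc.prems(2)[of "js @ [i]"] by (simp add: partials_append)
  have sw: "smooth (\<lambda>x. ?w j x * partial j f (\<phi> x))" for j
    by (rule smooth_mult[OF w smooth_compose[OF \<phi> smooth_partial[OF f]]])
  have su: "smooth (\<lambda>x. partial i u x * f (\<phi> x))"
    by (rule smooth_mult[OF smooth_partial[OF snoc.prems(1)] smooth_compose[OF \<phi> f]])
  have "partial i (\<lambda>x. u x * f (\<phi> x)) =
      (\<lambda>x. (\<Sum>j\<in>UNIV. ?w j x * partial j f (\<phi> x)) + partial i u x * f (\<phi> x))"
    using partial_mult[OF smoothD[OF snoc.prems(1)] smoothD[OF smooth_compose[OF \<phi> f]]]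
    by (simp add: partial_compose[OF \<phi> f] sum_distrib_left mult.assoc)
  then have "partials (is @ [i]) (\<lambda>x. u x * f (\<phi> x)) =
      (\<lambda>x. (\<Sum>j\<in>UNIV. partials is (\<lambda>x. ?w j x * partial j f (\<phi> x)) x)
        + partials is (\<lambda>x. partial i u x * f (\<phi> x)) x)"
    by (simp add: partials_append partials_add partials_sum smooth_sum sw su)
  moreover have "rapid (\<lambda>x. 0::real) (partials is (\<lambda>x. ?w j x * partial j f (\<phi> x)))" for j
    by (rule snoc.IH[OF w rw schwartz_partial[OF snoc.prems(3)]])
  moreover have "rapid (\<lambda>x. 0::real) (partials is (\<lambda>x. partial i u x * f (\<phi> x)))"
    by (rule snoc.IH[OF smooth_partial[OF snoc.prems(1)] ru snoc.prems(3)])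
  ultimately show ?case by (simp add: rapid_add rapid_sum)
qed

lemma acts_on_schwartzI:
  fixes \<phi> :: "real^('d::finite) \<Rightarrow> real^'d"
  assumes "smooth \<phi>" "smooth \<psi>" "\<And>is. rapid \<phi> (partials is \<psi>)"
    and "\<And>is j. moderate \<phi> (partials is (\<lambda>x. complex_of_real (\<phi> x $ j)))"
  shows "acts_on_schwartz \<psi> \<phi>"
  unfolding acts_on_schwartz_def weighted_comp_def
proof
  fix f :: "real^'d \<Rightarrow> complex" assume f: "f \<in> schwartz"
  then have "smooth f" by (simp add: schwartz_iff)
  then show "(\<lambda>x. \<psi> x * f (\<phi> x)) \<in> schwartz"
    unfolding schwartz_iff
    using rapid_partials_mult_compose[OF assms(1,4,2,3) f] smooth_mult[OF assms(2) smooth_compose[OF assms(1)]]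
    by blast
qed

section \<open>Real exponents and multi-indices\<close>

text \<open>All large exponents are provided, because the theorem asks for one q that serves two
  bounds.\<close>

lemma moderate_imp_bdd_above:
  assumes "moderate \<phi> u"
  obtains q\<^sub>0 where "\<And>q. q \<ge> q\<^sub>0 \<Longrightarrow> bdd_above (range (\<lambda>x. 1 / (1 + norm (\<phi> x)) powr q * norm (u x)))"
proof -
  obtain q C where C: "C \<ge> 0" "\<And>x. norm (u x) \<le> C * (1 + norm (\<phi> x)) ^ q"
    by (rule moderate_bound[OF assms], rule that)
  have "bdd_above (range (\<lambda>x. 1 / (1 + norm (\<phi> x)) powr r * norm (u x)))" if r: "r \<ge> real q" for r
  proof (rule bdd_aboveI2)
    fix x
    have pos: "0 < 1 + norm (\<phi> x)" by (simp add: add_pos_nonneg)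
    have "norm (u x) \<le> C * (1 + norm (\<phi> x)) powr real q"
      using C(2)[of x] pos by (simp add: powr_realpow)
    also have "\<dots> \<le> C * (1 + norm (\<phi> x)) powr r"
      by (intro mult_left_mono powr_mono C r) auto
    finally show "1 / (1 + norm (\<phi> x)) powr r * norm (u x) \<le> C"
      using pos by (simp add: divide_le_eq)
  qed
  then show thesis by (rule that)
qed

lemma bdd_above_imp_moderate:
  assumes "bdd_above (range (\<lambda>x. 1 / (1 + norm (\<phi> x)) powr q * norm (u x)))"
  shows "moderate \<phi> u"
proof -
  obtain C where C: "\<And>x. 1 / (1 + norm (\<phi> x)) powr q * norm (u x) \<le> C"
    using assms by (auto simp: bdd_above_def)
  have "norm (u x) \<le> C * (1 + norm (\<phi> x)) ^ nat \<lceil>q\<rceil>" for x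
  proof -
    have pos: "0 < 1 + norm (\<phi> x)" by (simp add: add_pos_nonneg)
    have "0 \<le> C" using C[of x] by (rule order_trans[rotated]) simp
    have "norm (u x) \<le> C * (1 + norm (\<phi> x)) powr q"
      using C[of x] pos by (simp add: divide_le_eq)
    also have "\<dots> \<le> C * (1 + norm (\<phi> x)) powr real (nat \<lceil>q\<rceil>)"
      by (intro mult_left_mono powr_mono real_nat_ceiling_ge \<open>0 \<le> C\<close>) auto
    finally show ?thesis using pos by (simp add: powr_realpow)
  qed
  then show ?thesis by (rule moderateI)
qed

lemma norm_partials_component:
  fixes \<phi> :: "real^('d::finite) \<Rightarrow> real^('e::finite)"
  assumes "smooth \<phi>"
  shows "cmod (partials is (\<lambda>x. complex_of_real (\<phi> x $ j)) x) = \<bar>partials is (\<lambda>x. \<phi> x $ j) x\<bar>"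
  by (simp add: partials_bounded_linear[OF bounded_linear_of_real
      smooth_bounded_linear[OF bounded_linear_vec_nth assms]])

lemma mderiv_vec_moderate_iff:
  fixes \<phi> :: "real^('d::finite) \<Rightarrow> real^('e::finite)"
  assumes "smooth \<phi>"
  shows "(\<forall>\<alpha>. moderate \<phi> (mderiv_vec \<alpha> \<phi>)) \<longleftrightarrow>
    (\<forall>is j. moderate \<phi> (partials is (\<lambda>x. complex_of_real (\<phi> x $ j))))"
proof (intro iffI allI)
  fix "is" j
  assume L: "\<forall>\<alpha>. moderate \<phi> (mderiv_vec \<alpha> \<phi>)"
  have "partials is (\<lambda>x. \<phi> x $ j) = mderiv (count_list is) (\<lambda>x. \<phi> x $ j)"
    by (rule partials_eq_mderiv[OF smooth_bounded_linear[OF bounded_linear_vec_nth assms]])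
  then have "\<bar>partials is (\<lambda>x. \<phi> x $ j) x\<bar> \<le> norm (mderiv_vec (count_list is) \<phi> x)" for x
    using component_le_norm_cart[of "mderiv_vec (count_list is) \<phi> x" j] by (simp add: mderiv_vec_def)
  then show "moderate \<phi> (partials is (\<lambda>x. complex_of_real (\<phi> x $ j)))"
    by (intro moderate_dominated[OF L[rule_format]]) (simp only: norm_partials_component[OF assms])
next
  fix \<alpha> :: "'d \<Rightarrow> nat"
  assume R: "\<forall>is j. moderate \<phi> (partials is (\<lambda>x. complex_of_real (\<phi> x $ j)))"
  \<comment> \<open>The list chosen by \<open>mderiv\<close> depends on \<alpha> alone, so all
    components share it.\<close>
  obtain "is" where eq: "\<And>f :: real^'d \<Rightarrow> real. mderiv \<alpha> f = partials is f"
    unfolding mderiv_def by blast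
  have "moderate \<phi> (\<lambda>x. \<Sum>j\<in>J. cmod (partials is (\<lambda>x. complex_of_real (\<phi> x $ j)) x))" if "finite J" for J
    using that
  proof (induction J rule: finite_induct)
    case empty
    then show ?case by (intro moderateI[of _ 0 _ 0]) simp
  next
    case (insert j J)
    have "moderate \<phi> (\<lambda>x. cmod (partials is (\<lambda>x. complex_of_real (\<phi> x $ j)) x))"
      by (rule moderate_dominated[OF R[rule_format, of "is" j]]) simp
    with insert show ?case by (simp add: moderate_add)
  qed
  from this[of UNIV] show "moderate \<phi> (mderiv_vec \<alpha> \<phi>)"
  proof (rule moderate_dominated)
    fix x
    have "norm (mderiv_vec \<alpha> \<phi> x) \<le> (\<Sum>j\<in>UNIV. \<bar>mderiv_vec \<alpha> \<phi> x $ j\<bar>)" by (rule norm_le_l1_cart)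
    then show "norm (mderiv_vec \<alpha> \<phi> x)
        \<le> norm (\<Sum>j\<in>UNIV. cmod (partials is (\<lambda>x. complex_of_real (\<phi> x $ j)) x))"
      by (simp add: norm_partials_component[OF assms] mderiv_vec_def eq)
  qed simp
qed

lemma rapid_imp_moderate_powr:
  fixes \<phi> :: "'a::real_normed_vector \<Rightarrow> 'b::real_normed_vector" and u :: "'a \<Rightarrow> 'c::real_normed_vector"
  assumes "rapid \<phi> u"
  shows "moderate \<phi> (\<lambda>x. (1 + norm x) powr p *\<^sub>R u x)"
proof (rule moderate_dominated)
  show "moderate \<phi> (\<lambda>x. (1 + norm x) ^ nat \<lceil>p\<rceil> *\<^sub>R u x)" using assms by (simp add: rapid_def)
  fix x :: 'a
  have "(1 + norm x) powr p \<le> (1 + norm x) powr real (nat \<lceil>p\<rceil>)"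
    by (intro powr_mono real_nat_ceiling_ge) auto
  then have "(1 + norm x) powr p \<le> (1 + norm x) ^ nat \<lceil>p\<rceil>"
    by (simp add: powr_realpow add_pos_nonneg)
  then show "norm ((1 + norm x) powr p *\<^sub>R u x) \<le> norm ((1 + norm x) ^ nat \<lceil>p\<rceil> *\<^sub>R u x)"
    by (auto intro: mult_right_mono)
qed

lemma moderate_powr_imp_rapid:
  fixes \<phi> :: "'a::real_normed_vector \<Rightarrow> 'b::real_normed_vector" and u :: "'a \<Rightarrow> 'c::real_normed_vector"
  assumes "\<And>p. p > 0 \<Longrightarrow> moderate \<phi> (\<lambda>x. (1 + norm x) powr p *\<^sub>R u x)"
  shows "rapid \<phi> u"
  unfolding rapid_def
proof
  fix p :: nat
  show "moderate \<phi> (\<lambda>x. (1 + norm x) ^ p *\<^sub>R u x)"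
  proof (rule moderate_dominated)
    \<comment> \<open>The assumption covers positive exponents only, so the weight with exponent 0
      is reached through the successor.\<close>
    show "moderate \<phi> (\<lambda>x. (1 + norm x) powr real (Suc p) *\<^sub>R u x)" by (rule assms) simp
    fix x :: 'a
    have "(1 + norm x) ^ p \<le> (1 + norm x) ^ Suc p" by (intro power_increasing) auto
    also have "\<dots> = (1 + norm x) powr real (Suc p)"
      by (rule powr_realpow[symmetric]) (simp add: add_pos_nonneg)
    finally show "norm ((1 + norm x) ^ p *\<^sub>R u x) \<le> norm ((1 + norm x) powr real (Suc p) *\<^sub>R u x)"
      unfolding norm_scaleR by (intro mult_right_mono) auto
  qed
qed

theorem theorem3p3:
  fixes \<phi> :: "real^'d \<Rightarrow> real^('d::finite)" and \<psi> :: "real^'d \<Rightarrow> complex"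
  assumes "smooth \<phi>"
    and "smooth \<psi>"
    and "small_decay \<psi> \<phi>"
  shows "acts_on_schwartz \<psi> \<phi> \<longleftrightarrow>
    (\<forall>(\<alpha> :: 'd \<Rightarrow> nat) (p::real). p > 0 \<longrightarrow> (\<exists>q::real. q > 0 \<and>
       bdd_above (range (\<lambda>x. (1 + norm x) powr p / (1 + norm (\<phi> x)) powr q * cmod (mderiv \<alpha> \<psi> x))) \<and>
       bdd_above (range (\<lambda>x. 1 / (1 + norm (\<phi> x)) powr q * norm (mderiv_vec \<alpha> \<phi> x)))))"
proof -
  \<comment> \<open>Moving the weight in x into the function gives both suprema the same form, so
    the same two translation lemmas handle both.\<close>
  have weight: "(1 + norm x) powr p / (1 + norm (\<phi> x)) powr q * cmod (u x) =
      1 / (1 + norm (\<phi> x)) powr q * norm ((1 + norm x) powr p *\<^sub>R u x)" for x p q and u :: "real^'d \<Rightarrow> complex"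
    by simp
  show ?thesis
    unfolding weight
  proof (intro iffI allI impI)
    fix \<alpha> :: "'d \<Rightarrow> nat" and p :: real
    assume acts: "acts_on_schwartz \<psi> \<phi>"
    have "rapid \<phi> (mderiv \<alpha> \<psi>)"
      unfolding mderiv_def by (rule acts_imp_rapid[OF assms(1,2) acts])
    then have "moderate \<phi> (\<lambda>x. (1 + norm x) powr p *\<^sub>R mderiv \<alpha> \<psi> x)"
      by (rule rapid_imp_moderate_powr)
    then obtain q\<^sub>1 where q1: "\<And>q. q \<ge> q\<^sub>1 \<Longrightarrow> bdd_above (range (\<lambda>x.
        1 / (1 + norm (\<phi> x)) powr q * norm ((1 + norm x) powr p *\<^sub>R mderiv \<alpha> \<psi> x)))"
      by (rule moderate_imp_bdd_above) (rule that)
    have "moderate \<phi> (mderiv_vec \<alpha> \<phi>)"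
      using acts_imp_moderate[OF assms acts] mderiv_vec_moderate_iff[OF assms(1)] by blast
    then obtain q\<^sub>2 where q2: "\<And>q. q \<ge> q\<^sub>2 \<Longrightarrow> bdd_above (range (\<lambda>x.
        1 / (1 + norm (\<phi> x)) powr q * norm (mderiv_vec \<alpha> \<phi> x)))"
      by (rule moderate_imp_bdd_above) (rule that)
    show "\<exists>q>0. bdd_above (range (\<lambda>x.
          1 / (1 + norm (\<phi> x)) powr q * norm ((1 + norm x) powr p *\<^sub>R mderiv \<alpha> \<psi> x))) \<and>
        bdd_above (range (\<lambda>x. 1 / (1 + norm (\<phi> x)) powr q * norm (mderiv_vec \<alpha> \<phi> x)))"
      \<comment> \<open>The 1 makes q positive, as the thresholds may be negative.\<close>
      by (rule exI[of _ "max 1 (max q\<^sub>1 q\<^sub>2)"]) (intro conjI q1 q2; simp)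
  next
    assume R: "\<forall>\<alpha> p. p > 0 \<longrightarrow> (\<exists>q>0. bdd_above (range (\<lambda>x.
          1 / (1 + norm (\<phi> x)) powr q * norm ((1 + norm x) powr p *\<^sub>R mderiv \<alpha> \<psi> x))) \<and>
        bdd_above (range (\<lambda>x. 1 / (1 + norm (\<phi> x)) powr q * norm (mderiv_vec \<alpha> \<phi> x))))"
    have "rapid \<phi> (partials is \<psi>)" for "is"
      unfolding partials_eq_mderiv[OF assms(2)]
    proof (rule moderate_powr_imp_rapid)
      fix p :: real assume "p > 0"
      from R[rule_format, OF this, of "count_list is"]
      show "moderate \<phi> (\<lambda>x. (1 + norm x) powr p *\<^sub>R mderiv (count_list is) \<psi> x)"
        by (elim exE conjE) (rule bdd_above_imp_moderate)
    qed
    moreover have "moderate \<phi> (mderiv_vec \<alpha> \<phi>)" for \<alpha>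
      \<comment> \<open>Any positive p yields the bound on the derivatives of \<phi>; 1 is
        taken.\<close>
      using R[rule_format, of 1 \<alpha>] by (auto intro: bdd_above_imp_moderate)
    then have "moderate \<phi> (partials is (\<lambda>x. complex_of_real (\<phi> x $ j)))" for "is" j
      using mderiv_vec_moderate_iff[OF assms(1)] by blast
    ultimately show "acts_on_schwartz \<psi> \<phi>"
      by (rule acts_on_schwartzI[OF assms(1,2)])
  qed
qed

end
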